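(* There exist universal constants $K,\kappa>0$ such that the following holds. Let $f_0\in L^1_+(0,\infty)$ be a probability density and consider, for each even positive integer $n$, the $n$-particle system with law $\mathbb{P}_n$ started from $(a_1,\dots,a_n)$, with empirical measure $F^n(t)$ (all defined in the context). For every $\varepsilon>0$ and $T>0$ there exist $n_\varepsilon$, $M_\varepsilon$, $N_\varepsilon$, independent of $n$, such that for all even $n\ge n_\varepsilon$ $$\mathbb{P}_n\left(\sup_{t\in[0,T]} d\left(F^n(t),\rho(t)S_t^*F_0\right)>\varepsilon\right)\le K\left(M_\varepsilon N_\varepsilon+\frac1\varepsilon\right)e^{-\kappa n\varepsilon^2}.$$ Here $M_\varepsilon$ depends on $\varepsilon$ and the tail of $F_0$ but not on $T$, and $N_\varepsilon$ depends on $\varepsilon$, the modulus of continuity of $F_0$, and $T$.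
   Context: Particle system. Let $F_0(x)=\int_0^x f_0(y)\,dy$ and, for an even positive integer $n$, let $a_k=F_0^{-1}\left(\frac{2k-1}{2n}\right)$, $1\le k\le n$ ($F_0^{-1}$ is the generalized inverse; $0<a_1<\dots<a_n$ since $F_0$ is continuous). The system starts at time $0$ with $n$ particles at $a_1,\dots,a_n$. All particles move to the left at unit speed. Each time the left-most particle hits $0$, it is removed together with one other particle chosen uniformly at random (independently of the past) from the remaining particles in $(0,\infty)$; this is repeated until no particles remain. $\mathbb{P}_n$ denotes the law of the process. If the particles present at time $t$ are $x_1(t),\dots,x_m(t)$ (after any removal occurring at time $t$), the empirical measure is $F^n(t)=\frac1n\sum_{i=1}^m\delta_{x_i(t)}$. Notation. $\rho(t)=\int_t^\infty f_0(y)\,dy$. A measure and its distribution function $\mu(x)=\mu([0,x))$ are denoted by the same symbol; in particular $F_0$ also denotes the measure with density $f_0$. For $h\geq 0$, $(S_h\varphi)(x)=\varphi(x-h)\mathbf{1}_{x\ge h}$ and its dual on measures is $(S_h^*\mu)(x)=\mu(x+h)-\mu(h)$, i.e. $\langle S_h^*\mu,\varphi\rangle=\langle\mu,S_h\varphi\rangle$, where $\langle\mu,\varphi\rangle=\int\varphi\,d\mu$. For finite positive measures $\mu,\nu$ on $\mathbb{R}_+=[0,\infty)$, $d(\mu,\nu)=\sup_{\|\varphi\|_{BL}\le1}\langle\mu-\nu,\varphi\rangle$, where $\|\varphi\|_{BL}=\sup_x|\varphi(x)|+\sup_{x\ne y}\frac{|\varphi(x)-\varphi(y)|}{|x-y|}$.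 *)

theory Defs
  imports "HOL-Probability.Probability"
begin

text \<open>A probability density in \<open>L\<^sup>1\<^sub>+(0,\<infinity>)\<close> is represented by a Borel function on the real
  line that vanishes outside \<open>(0,\<infinity>)\<close>.\<close>

definition half_line_density :: "(real \<Rightarrow> real) \<Rightarrow> bool" where
  "half_line_density f0 \<longleftrightarrow>
     f0 \<in> borel_measurable borel \<and> (\<forall>x. 0 \<le> f0 x) \<and> (\<forall>x\<le>0. f0 x = 0) \<and>
     integrable lborel f0 \<and> (LBINT x. f0 x) = 1"

definition F0_cdf :: "(real \<Rightarrow> real) \<Rightarrow> real \<Rightarrow> real" where
  "F0_cdf f0 x = (LBINT y:{0..x}. f0 y)"

definition F0_measure :: "(real \<Rightarrow> real) \<Rightarrow> real measure" where
  "F0_measure f0 = density lborel (\<lambda>x. ennreal (f0 x))"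

definition rho :: "(real \<Rightarrow> real) \<Rightarrow> real \<Rightarrow> real" where
  "rho f0 t = (LBINT y:{t..}. f0 y)"

definition F0_modulus :: "(real \<Rightarrow> real) \<Rightarrow> real \<Rightarrow> real" where
  "F0_modulus f0 \<delta> =
     (SUP (x, y) \<in> {(x, y). 0 \<le> x \<and> 0 \<le> y \<and> \<bar>x - y\<bar> \<le> \<delta>}. \<bar>F0_cdf f0 x - F0_cdf f0 y\<bar>)"

definition F0_inverse :: "(real \<Rightarrow> real) \<Rightarrow> real \<Rightarrow> real" where
  "F0_inverse f0 u = Inf {x. 0 \<le> x \<and> u \<le> F0_cdf f0 x}"

definition start :: "(real \<Rightarrow> real) \<Rightarrow> nat \<Rightarrow> nat \<Rightarrow> real" where
  "start f0 n k = F0_inverse f0 ((2 * real k - 1) / (2 * real n))"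

text \<open>A particle is identified with its initial position, these being pairwise distinct. Since
  all particles move left at unit speed, a particle \<open>x\<close> that has not been removed sits at
  \<open>x - t\<close> at time \<open>t\<close> and hits the origin at time \<open>x\<close>; the left-most particle of a set \<open>S\<close> of
  survivors is \<open>Min S\<close>. A realisation of the process is recorded as the list of removed
  pairs (particle hitting the origin, partner removed with it), in chronological order; the
  pair \<open>(x, y)\<close> is removed at time \<open>x\<close>.\<close>

function removal_law :: "real set \<Rightarrow> (real \<times> real) list pmf" where
  "removal_law S =
     (if finite S \<and> 2 \<le> card S
      then bind_pmf (pmf_of_set (S - {Min S}))
             (\<lambda>y. map_pmf ((#) (Min S, y)) (removal_law (S - {Min S, y})))
      else return_pmf [])"
  by pat_completeness auto
termination
proof (relation "Wellfounded.measure card", goal_cases)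
  case (2 S y)
  then have "S \<noteq> {}" by auto
  with 2 have "S - {Min S, y} \<subset> S" using Min_in[of S] by blast
  with 2 show ?case by (simp add: psubset_card_mono)
qed simp

declare removal_law.simps [simp del]

definition particle_law :: "(real \<Rightarrow> real) \<Rightarrow> nat \<Rightarrow> (real \<times> real) list pmf" where
  "particle_law f0 n = removal_law (start f0 n ` {1..n})"

definition survivors :: "real set \<Rightarrow> (real \<times> real) list \<Rightarrow> real \<Rightarrow> real set" where
  "survivors A H t = A - (\<Union>(x, y) \<in> {(x, y) \<in> set H. x \<le> t}. {x, y})"

text \<open>The image of the counting measure on the survivors under \<open>x \<mapsto> x - t\<close> is the sum of
  the Dirac masses at their current positions.\<close>

definition empirical :: "(real \<Rightarrow> real) \<Rightarrow> nat \<Rightarrow> (real \<times> real) list \<Rightarrow> real \<Rightarrow> real measure" where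
  "empirical f0 n H t =
     scale_measure (ennreal (1 / real n))
       (distr (count_space (survivors (start f0 n ` {1..n}) H t)) borel (\<lambda>x. x - t))"

text \<open>Measures on \<open>[0,\<infinity>)\<close> are measures on the Borel sets of the real line that do not
  charge the negative half-line. The operator \<open>S\<^sub>h\<^sup>*\<close> sends \<open>\<mu>\<close> to the image of its restriction
  to \<open>[h,\<infinity>)\<close> under \<open>x \<mapsto> x - h\<close>.\<close>

definition shift_dual :: "real \<Rightarrow> real measure \<Rightarrow> real measure" where
  "shift_dual h \<mu> = distr (restrict_space \<mu> {h..}) borel (\<lambda>x. x - h)"

definition limit_measure :: "(real \<Rightarrow> real) \<Rightarrow> real \<Rightarrow> real measure" where
  "limit_measure f0 t = scale_measure (ennreal (rho f0 t)) (shift_dual t (F0_measure f0))"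

text \<open>Test functions live on \<open>[0,\<infinity>)\<close>: their values at negative arguments are irrelevant
  both for the norm and for the distance. The suprema are taken in the extended reals, so
  that unbounded or non-Lipschitz functions have norm \<open>\<infinity>\<close>.\<close>

definition bl_norm :: "(real \<Rightarrow> real) \<Rightarrow> ereal" where
  "bl_norm \<phi> =
     (SUP x \<in> {0..}. ereal \<bar>\<phi> x\<bar>) +
     (SUP (x, y) \<in> {(x, y). 0 \<le> x \<and> 0 \<le> y \<and> x \<noteq> y}. ereal (\<bar>\<phi> x - \<phi> y\<bar> / \<bar>x - y\<bar>))"

definition bl_dist :: "real measure \<Rightarrow> real measure \<Rightarrow> ereal" where
  "bl_dist \<mu> \<nu> =
     (SUP \<phi> \<in> {\<phi>. bl_norm \<phi> \<le> 1}. ereal ((LINT x:{0..}|\<mu>. \<phi> x) - (LINT x:{0..}|\<nu>. \<phi> x)))"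

end

theory Submission
  imports Defs
begin

text \<open>
  Since each particle hitting the origin takes a uniformly chosen partner with it, the removed
  pairs form a uniformly random perfect matching of the initial particles, and a particle that
  started beyond \<open>t\<close> is present at time \<open>t\<close> iff its partner started beyond \<open>t\<close> as well. A fraction of
  about \<open>\<rho>(t)\<close> of the particles started there, so each of them survives with probability about \<open>\<rho>(t)\<close>.
  This explains the limit \<open>\<rho>(t) S\<^sub>t\<^sup>* F\<^sub>0\<close>.

  The deviations are controlled in one linear functional at a time. Fix \<open>t\<close> and a function \<open>g\<close> bounded by
  one. Revealing the pairs in chronological order, the conditional expectation of the sum of \<open>g\<close>
  over the survivors at time \<open>t\<close> has a closed form (\<open>expected_sum\<close>), is a martingale
  (\<open>expected_sum_martingale\<close>) and moves by at most \<open>4\<close> per removal (\<open>expected_sum_increment\<close>). There are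
  \<open>n / 2\<close> removals, so the Azuma-Hoeffding method gives Gaussian tails at scale \<open>\<surd>n\<close> with
  universal constants (\<open>survivor_sum_concentration\<close>).

  The supremum over test functions must not spoil the rate. Truncating the tail and cutting the
  half-line into cells of length of order \<open>\<epsilon>\<close>, it is enough to control the survivors in each of the finitely
  many unions of cells, each to within a fixed multiple of \<open>\<epsilon>\<close> (\<open>close_on_cells_imp_close\<close>). The supremum over
  times is reduced to a finite grid by monotonicity of the set of survivors
  (\<open>close_at_grid_imp_close\<close>). A union bound over grid times and unions of cells only enters the
  prefactor (\<open>exceedance_bound\<close>).\<close>

section \<open>The removal process as a recursion\<close>

text \<open>One removal takes two particles away, so an even number of particles stays even and the
  process ends with none left over. Facts about \<^const>\<open>removal_law\<close> are proved along this
  recursion; evenness is what guarantees a partner for the particle that hits the origin.\<close>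

lemma pairing_induct [consumes 2, case_names empty step]:
  fixes S :: "real set"
  assumes "finite S" "even (card S)"
    and "P {}"
    and step: "\<And>S. finite S \<Longrightarrow> even (card S) \<Longrightarrow> S \<noteq> {} \<Longrightarrow> S - {Min S} \<noteq> {} \<Longrightarrow>
      (\<And>y. y \<in> S - {Min S} \<Longrightarrow>
         P (S - {Min S, y}) \<and> even (card (S - {Min S, y})) \<and> card S = card (S - {Min S, y}) + 2) \<Longrightarrow> P S"
  shows "P S"
  using assms(1,2)
proof (induction S rule: measure_induct_rule[where f = card])
  case (less S)
  show ?case
  proof (cases "S = {}")
    case False
    have Min: "Min S \<in> S" using less.prems False by simp
    have ne: "S - {Min S} \<noteq> {}"
    proof
      assume "S - {Min S} = {}"
      then have "S = {Min S}" using Min by blast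
      then have "card S = 1" by (metis card_1_singleton_iff One_nat_def)
      with less.prems show False by simp
    qed
    have card: "card S = card (S - {Min S, y}) + 2" if "y \<in> S - {Min S}" for y
    proof -
      have "card {Min S, y} = 2" using that by simp
      moreover have "{Min S, y} \<subseteq> S" using that Min by simp
      ultimately show ?thesis
        using less.prems card_mono[of S "{Min S, y}"] by (simp add: card_Diff_subset)
    qed
    show ?thesis
    proof (rule step)
      fix y assume y: "y \<in> S - {Min S}"
      have ev: "even (card (S - {Min S, y}))" using card[OF y] less.prems(2) by simp
      then have "P (S - {Min S, y})"
        using less.IH[of "S - {Min S, y}"] card[OF y] less.prems by simp
      with ev card[OF y]
      show "P (S - {Min S, y}) \<and> even (card (S - {Min S, y})) \<and> card S = card (S - {Min S, y}) + 2"
        by simp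
    qed (use less.prems False ne in auto)
  qed (use assms in simp)
qed

lemma removal_law_empty: "removal_law {} = return_pmf []"
  by (simp add: removal_law.simps)

lemma removal_law_step:
  assumes "finite S" "S - {Min S} \<noteq> {}"
  shows "removal_law S = bind_pmf (pmf_of_set (S - {Min S}))
           (\<lambda>y. map_pmf ((#) (Min S, y)) (removal_law (S - {Min S, y})))"
proof -
  have "S \<noteq> {}" using assms by auto
  then have "Min S \<in> S" using assms by simp
  moreover obtain y where "y \<in> S - {Min S}" using assms by blast
  ultimately have "{Min S, y} \<subseteq> S" "card {Min S, y} = 2" by auto
  then have "2 \<le> card S" using assms(1) by (metis card_mono)
  then show ?thesis using assms(1) by (subst removal_law.simps) simp
qed

lemma set_removal_law_step:
  assumes "finite S" "S - {Min S} \<noteq> {}" "H \<in> set_pmf (removal_law S)"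
  obtains y H' where "y \<in> S - {Min S}" "H = (Min S, y) # H'"
    "H' \<in> set_pmf (removal_law (S - {Min S, y}))"
  using assms by (auto simp: removal_law_step)

lemma removed_pairs_in:
  assumes "finite S" "even (card S)" "H \<in> set_pmf (removal_law S)"
  shows "\<forall>(x, y) \<in> set H. x \<in> S \<and> y \<in> S"
  using assms
proof (induction S arbitrary: H rule: pairing_induct)
  case empty
  then show ?case by (simp add: removal_law_empty)
next
  case (step S)
  obtain y H' where H': "y \<in> S - {Min S}" "H = (Min S, y) # H'"
    "H' \<in> set_pmf (removal_law (S - {Min S, y}))"
    using set_removal_law_step[OF step(1) step(4) step.prems] .
  have "Min S \<in> S" using step by simp
  moreover have "\<forall>(x, y) \<in> set H'. x \<in> S \<and> y \<in> S"
    using step(5)[OF H'(1)] H'(3) by blast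
  ultimately show ?case using H'(1) by (simp add: H'(2))
qed

lemma survivors_Nil: "survivors A [] t = A"
  by (simp add: survivors_def)

lemma survivors_Cons_removed:
  "x \<le> t \<Longrightarrow> survivors A ((x, y) # H) t = survivors (A - {x, y}) H t"
  by (auto simp: survivors_def)

lemma survivors_before_first_hit:
  assumes "finite S" "even (card S)" "H \<in> set_pmf (removal_law S)" "\<And>x. x \<in> S \<Longrightarrow> t < x"
  shows "survivors S H t = S"
  using removed_pairs_in[OF assms(1-3)] assms(4) by (fastforce simp: survivors_def)

text \<open>With an even number of particles nobody is left without a partner: a particle that reaches the
  origin is removed at that moment, so that all survivors are still strictly to the right of it.\<close>

lemma survivors_gt:
  assumes "finite S" "even (card S)" "H \<in> set_pmf (removal_law S)"
  shows "survivors S H t \<subseteq> {t<..}"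
  using assms
proof (induction S arbitrary: H rule: pairing_induct)
  case empty
  then show ?case by (simp add: survivors_def)
next
  case (step S)
  obtain y H' where H': "y \<in> S - {Min S}" "H = (Min S, y) # H'"
    "H' \<in> set_pmf (removal_law (S - {Min S, y}))"
    using set_removal_law_step[OF step(1) step(4) step.prems] .
  show ?case
  proof (cases "Min S \<le> t")
    case True
    then show ?thesis using H' step(5)[OF H'(1)] by (simp add: survivors_Cons_removed)
  next
    case False
    then have "S \<subseteq> {t<..}" using step(1) step(3) by (auto simp: not_le)
    then show ?thesis by (auto simp: survivors_def)
  qed
qed

section \<open>The conditional expectation of the surviving mass is a martingale\<close>

text \<open>The removed pairs form a uniformly random perfect matching of \<open>S\<close>, and a particle \<open>x > t\<close>
  is still present at time \<open>t\<close> exactly when its partner also started beyond \<open>t\<close>. If \<open>b\<close> of the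
  \<open>m\<close> particles started there, the partner of \<open>x\<close> is one of the other \<open>b - 1\<close> of them
  with probability \<open>(b - 1) / (m - 1)\<close>. Hence this is the mean of the sum of \<open>g\<close> over the
  particles that survive time \<open>t\<close>.\<close>

definition expected_sum :: "real set \<Rightarrow> real \<Rightarrow> (real \<Rightarrow> real) \<Rightarrow> real" where
  "expected_sum S t g =
     (\<Sum>x\<in>S \<inter> {t<..}. g x) * (real (card (S \<inter> {t<..})) - 1) / (real (card S) - 1)"

context
  fixes S :: "real set" and t :: real and g :: "real \<Rightarrow> real"
  assumes fin: "finite S" and ev: "even (card S)" and ne: "S \<noteq> {}" and hit: "Min S \<le> t"
begin

private abbreviation "b \<equiv> real (card (S \<inter> {t<..}))"
private abbreviation "G \<equiv> (\<Sum>x\<in>S \<inter> {t<..}. g x)"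
private abbreviation "m \<equiv> real (card S)"

private lemma Min_S: "Min S \<in> S" "Min S \<notin> {t<..}"
  using Min_in[OF fin ne] hit by (simp_all only: greaterThan_iff not_less)

private lemma m_ge_2: "m \<ge> 2"
proof -
  have "card S \<noteq> 0" "card S \<noteq> 1" using fin ne ev by (auto dest: arg_cong[of _ _ even])
  then show ?thesis by simp
qed

private lemma m_ne_3: "m \<noteq> 3"
  using ev by (metis even_numeral numeral_3_eq_3 of_nat_eq_iff of_nat_numeral odd_numeral)

private lemma card_rest: "y \<in> S - {Min S} \<Longrightarrow> real (card (S - {Min S, y})) = m - 2"
  using fin Min_S m_ge_2 by (subst card_Diff_subset) (auto simp: of_nat_diff)

lemma expected_sum_partner_below:
  assumes "y \<in> S - {Min S}" "y \<le> t"
  shows "expected_sum (S - {Min S, y}) t g = G * (b - 1) / (m - 3)"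
proof -
  have "(S - {Min S, y}) \<inter> {t<..} = S \<inter> {t<..}" using Min_S assms by auto
  then show ?thesis using card_rest[OF assms(1)] by (simp add: expected_sum_def)
qed

lemma expected_sum_partner_above:
  assumes "y \<in> S \<inter> {t<..}"
  shows "expected_sum (S - {Min S, y}) t g = (G - g y) * (b - 2) / (m - 3)"
proof -
  have y: "y \<in> S - {Min S}" using assms Min_S by auto
  have eq: "(S - {Min S, y}) \<inter> {t<..} = S \<inter> {t<..} - {y}" using Min_S assms by auto
  have "0 < card (S \<inter> {t<..})" using assms fin by (auto simp: card_gt_0_iff)
  then have "real (card (S \<inter> {t<..} - {y})) = b - 1" using assms fin by (simp add: of_nat_diff Suc_le_eq)
  moreover have "sum g (S \<inter> {t<..} - {y}) = G - g y"
    using assms fin by (simp add: sum_diff1)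
  ultimately show ?thesis using card_rest[OF y] unfolding expected_sum_def eq by simp
qed

text \<open>The one-step average splits into partners below \<open>t\<close>, which leave \<open>b\<close> and \<open>G\<close> unchanged, and
  partners above \<open>t\<close>, each of which lowers \<open>b\<close> by one and \<open>G\<close> by its own value. The factor
  \<open>m - 3\<close> that remains in the numerator cancels the denominator; it is nonzero because \<open>m\<close> is even.\<close>

lemma expected_sum_martingale:
  "(\<Sum>y\<in>S - {Min S}. expected_sum (S - {Min S, y}) t g) = (m - 1) * expected_sum S t g"
proof -
  define A where "A = S - {Min S} - {t<..}"
  have split: "S - {Min S} = A \<union> (S \<inter> {t<..})" "A \<inter> (S \<inter> {t<..}) = {}" "finite A"
    using Min_S fin by (auto simp: A_def)
  have "card (S - {Min S}) = card A + card (S \<inter> {t<..})"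
    using split fin by (metis card_Un_disjoint finite_Int)
  moreover have "real (card (S - {Min S})) = m - 1"
    using fin Min_S m_ge_2 by (simp add: of_nat_diff)
  ultimately have cA: "real (card A) = m - 1 - b" by linarith
  have "(\<Sum>y\<in>A. expected_sum (S - {Min S, y}) t g) = (\<Sum>y\<in>A. G * (b - 1) / (m - 3))"
    by (intro sum.cong refl expected_sum_partner_below) (auto simp: A_def)
  also have "\<dots> = (m - 1 - b) * (G * (b - 1) / (m - 3))" by (simp add: cA)
  finally have 1: "(\<Sum>y\<in>A. expected_sum (S - {Min S, y}) t g) = (m - 1 - b) * (G * (b - 1) / (m - 3))" .
  have "(\<Sum>y\<in>S \<inter> {t<..}. expected_sum (S - {Min S, y}) t g)
      = (\<Sum>y\<in>S \<inter> {t<..}. (G - g y) * ((b - 2) / (m - 3)))"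
    by (intro sum.cong refl) (simp add: expected_sum_partner_above)
  also have "\<dots> = (b * G - G) * ((b - 2) / (m - 3))"
    by (subst sum_distrib_right[symmetric]) (simp add: sum_subtractf)
  finally have 2: "(\<Sum>y\<in>S \<inter> {t<..}. expected_sum (S - {Min S, y}) t g) = (b * G - G) * ((b - 2) / (m - 3))" .
  have "(\<Sum>y\<in>S - {Min S}. expected_sum (S - {Min S, y}) t g)
      = (m - 1 - b) * (G * (b - 1) / (m - 3)) + (b * G - G) * ((b - 2) / (m - 3))"
    unfolding 1[symmetric] 2[symmetric] using split fin by (simp add: sum.union_disjoint)
  also have "\<dots> = G * (b - 1) * ((m - 1 - b) + (b - 2)) / (m - 3)"
    by (simp add: algebra_simps add_divide_distrib diff_divide_distrib)
  also have "\<dots> = G * (b - 1)" using m_ne_3 by simp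
  also have "\<dots> = (m - 1) * expected_sum S t g"
    using m_ge_2 by (simp add: expected_sum_def)
  finally show ?thesis .
qed

text \<open>A removal changes \<open>G\<close> by at most one and the survival probability \<open>(b - 1) / (m - 1)\<close> by a term of
  order \<open>1 / m\<close>, while \<open>\<bar>G\<bar> \<le> b < m\<close>. For \<open>m \<ge> 4\<close> this gives a bounded increment, the
  constant coming from \<open>m - 1 \<le> 3 (m - 3)\<close>; for \<open>m = 2\<close> the expectation is zero before and after.\<close>

lemma expected_sum_increment:
  assumes g: "\<And>x. x \<in> S \<Longrightarrow> \<bar>g x\<bar> \<le> 1" and y: "y \<in> S - {Min S}"
  shows "\<bar>expected_sum (S - {Min S, y}) t g - expected_sum S t g\<bar> \<le> 4"
proof -
  have "\<bar>G\<bar> \<le> (\<Sum>x\<in>S \<inter> {t<..}. \<bar>g x\<bar>)" by (rule sum_abs)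
  also have "\<dots> \<le> b * 1" by (rule sum_bounded_above) (use g in auto)
  finally have G: "\<bar>G\<bar> \<le> b" by simp
  have b1: "b \<le> m - 1"
  proof -
    have "card (S \<inter> {t<..}) \<le> card (S - {Min S})" using fin Min_S by (intro card_mono) auto
    then show ?thesis using fin Min_S m_ge_2 by (simp add: of_nat_diff)
  qed
  have ES: "expected_sum S t g = G * (b - 1) / (m - 1)" by (simp add: expected_sum_def)
  consider "m = 2" | "m \<ge> 4"
  proof -
    have "card S \<noteq> 3" using ev by auto
    then show ?thesis using m_ge_2 that by fastforce
  qed
  then show ?thesis
  proof cases
    case 1
    then have "S - {Min S, y} = {}" using card_rest[OF y] fin by simp
    then have "expected_sum (S - {Min S, y}) t g = 0" by (simp only: expected_sum_def) simp
    moreover have "G * (b - 1) = 0"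
    proof (cases "card (S \<inter> {t<..}) = 0")
      case True
      then show ?thesis using G by simp
    next
      case False
      then show ?thesis using b1 1 by simp
    qed
    ultimately show ?thesis by (simp only: ES div_0 diff_self abs_zero)
  next
    case 2
    show ?thesis
    proof (cases "y \<le> t")
      case True
      have b2: "b \<le> m - 2"
      proof -
        have "card (S \<inter> {t<..}) \<le> card (S - {Min S, y})"
          using fin Min_S True by (intro card_mono) auto
        then show ?thesis using card_rest[OF y] by linarith
      qed
      have "expected_sum (S - {Min S, y}) t g - expected_sum S t g
          = 2 * (G * (b - 1)) / ((m - 1) * (m - 3))"
        using 2 unfolding expected_sum_partner_below[OF y True] ES
        by (simp add: field_simps)
      moreover have "\<bar>2 * (G * (b - 1))\<bar> \<le> 4 * ((m - 1) * (m - 3))"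
      proof (cases "card (S \<inter> {t<..}) = 0")
        case True
        then show ?thesis using G 2 by simp
      next
        case False
        then have "b \<ge> 1" by simp
        have "\<bar>G\<bar> * (b - 1) \<le> (m - 1) * (m - 3)"
          using G b2 \<open>b \<ge> 1\<close> 2 by (intro mult_mono) auto
        moreover have "\<bar>2 * (G * (b - 1))\<bar> = 2 * (\<bar>G\<bar> * (b - 1))"
          using \<open>b \<ge> 1\<close> by (simp add: abs_mult)
        moreover have "0 \<le> (m - 1) * (m - 3)" using 2 by simp
        ultimately show ?thesis by linarith
      qed
      ultimately show ?thesis using 2 by (simp add: abs_divide abs_mult divide_le_eq)
    next
      case False
      then have yB: "y \<in> S \<inter> {t<..}" using y by auto
      then have "card (S \<inter> {t<..}) > 0" using fin by (auto simp: card_gt_0_iff)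
      then have "b \<ge> 1" by simp
      have "expected_sum (S - {Min S, y}) t g - expected_sum S t g
          = G * (2 * b - m - 1) / ((m - 1) * (m - 3)) - g y * (b - 2) / (m - 3)"
      proof -
        have "(b - 2) / (m - 3) - (b - 1) / (m - 1) = (2 * b - m - 1) / ((m - 1) * (m - 3))"
          using 2 by (simp add: field_simps)
        then have "G * ((b - 2) / (m - 3) - (b - 1) / (m - 1)) = G * (2 * b - m - 1) / ((m - 1) * (m - 3))"
          by (simp only: times_divide_eq_right)
        then show ?thesis unfolding expected_sum_partner_above[OF yB] ES
          by (simp only: left_diff_distrib right_diff_distrib diff_divide_distrib times_divide_eq_right)
      qed
      moreover have "\<bar>G * (2 * b - m - 1) / ((m - 1) * (m - 3))\<bar> \<le> 3"
      proof -
        have "\<bar>G\<bar> * \<bar>2 * b - m - 1\<bar> \<le> (m - 1) * (m - 1)"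
          using G b1 \<open>b \<ge> 1\<close> 2 by (intro mult_mono) auto
        also have "\<dots> \<le> (m - 1) * (3 * (m - 3))" using 2 by (intro mult_left_mono) auto
        finally have "\<bar>G\<bar> * \<bar>2 * b - m - 1\<bar> \<le> 3 * ((m - 1) * (m - 3))" by (simp only: mult_ac)
        then show ?thesis using 2 by (simp add: abs_divide abs_mult divide_le_eq)
      qed
      moreover have "\<bar>g y * (b - 2) / (m - 3)\<bar> \<le> 1"
      proof -
        have "\<bar>g y\<bar> * \<bar>b - 2\<bar> \<le> 1 * (m - 3)"
          using g[of y] y b1 \<open>b \<ge> 1\<close> 2 by (intro mult_mono) auto
        then show ?thesis using 2 by (simp add: abs_divide abs_mult divide_le_eq)
      qed
      ultimately show ?thesis by linarith
    qed
  qed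
qed

end

section \<open>Concentration of the surviving mass\<close>

lemma hoeffding_pmf:
  fixes f :: "'a \<Rightarrow> real"
  assumes "measure_pmf.expectation p f = 0" "\<And>x. x \<in> set_pmf p \<Longrightarrow> \<bar>f x\<bar> \<le> c" "0 < l"
  shows "(\<integral>\<^sup>+x. ennreal (exp (l * f x)) \<partial>measure_pmf p) \<le> ennreal (exp (l\<^sup>2 * c\<^sup>2 / 2))"
proof -
  interpret interval_bounded_random_variable "measure_pmf p" f "- c" c
    by unfold_locales (use assms(2) in \<open>fastforce simp: AE_measure_pmf_iff abs_le_iff\<close>)+
  show ?thesis
    using Hoeffdings_lemma_nn_integral_0[OF assms(3,1)] by (simp add: power2_eq_square field_simps)
qed

text \<open>The Azuma-Hoeffding argument, carried out along the recursion that defines the process. Once the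
  left-most particle starts beyond \<open>t\<close>, nothing is removed up to time \<open>t\<close> and the survivor sum
  equals its expectation. Otherwise Hoeffding's lemma charges a factor \<open>exp (8 l\<^sup>2)\<close> for one
  martingale increment in \<open>[-4, 4]\<close>, which pays for the two particles that leave.\<close>

lemma survivor_sum_exp_moment:
  assumes "finite S" "even (card S)" "\<And>x. x \<in> S \<Longrightarrow> \<bar>g x\<bar> \<le> 1" "0 < l"
  shows "(\<integral>\<^sup>+H. ennreal (exp (l * ((\<Sum>x\<in>survivors S H t. g x) - expected_sum S t g))) \<partial>removal_law S)
           \<le> ennreal (exp (4 * l\<^sup>2 * card S))"
  using assms
proof (induction S rule: pairing_induct)
  case empty
  then show ?case by (simp add: removal_law_empty survivors_Nil expected_sum_def)
next
  case (step S)
  note [simp] = step(1)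
  show ?case
  proof (cases "Min S \<le> t")
    case False
    then have gt: "\<And>x. x \<in> S \<Longrightarrow> t < x" using step(1) Min_le less_le_trans not_le by metis
    then have "S \<inter> {t<..} = S" by auto
    moreover have "card S \<noteq> 1" using step(2) by auto
    ultimately have "expected_sum S t g = sum g S" by (simp add: expected_sum_def)
    moreover have "AE H in removal_law S. survivors S H t = S"
      using survivors_before_first_hit[OF step(1,2) _ gt] by (simp add: AE_measure_pmf_iff)
    ultimately have "(\<integral>\<^sup>+H. ennreal (exp (l * ((\<Sum>x\<in>survivors S H t. g x) - expected_sum S t g))) \<partial>removal_law S)
        = (\<integral>\<^sup>+H. 1 \<partial>removal_law S)"
      by (intro nn_integral_cong_AE) (erule eventually_mono, simp)
    then show ?thesis by simp
  next
    case True
    let ?P = "pmf_of_set (S - {Min S})"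
    let ?E = "\<lambda>y. expected_sum (S - {Min S, y}) t g - expected_sum S t g"
    have set_P [simp]: "set_pmf ?P = S - {Min S}" using step by simp
    have card1: "real (card (S - {Min S})) = real (card S) - 1" 
    proof -
      have "card S > 0" using step by (simp add: card_gt_0_iff)
      then show ?thesis using step by (simp add: of_nat_diff Suc_le_eq)
    qed
    have card1_pos: "real (card (S - {Min S})) > 0" using step by (simp add: card_gt_0_iff del: card_Diff_insert)
    have mean: "measure_pmf.expectation ?P ?E = 0"
      using expected_sum_martingale[OF step(1,2,3) True, of g] card1 card1_pos step(4)
      by (subst integral_pmf_of_set) (auto simp: sum_subtractf)
    have "(\<integral>\<^sup>+H. ennreal (exp (l * ((\<Sum>x\<in>survivors S H t. g x) - expected_sum S t g))) \<partial>removal_law S)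
      = (\<integral>\<^sup>+y. \<integral>\<^sup>+H. ennreal (exp (l * ((\<Sum>x\<in>survivors (S - {Min S, y}) H t. g x) - expected_sum S t g)))
          \<partial>removal_law (S - {Min S, y}) \<partial>?P)"
      using step(4) True by (simp add: removal_law_step survivors_Cons_removed)
    also have "\<dots> = (\<integral>\<^sup>+y. ennreal (exp (l * ?E y)) * (\<integral>\<^sup>+H. ennreal (exp (l * ((\<Sum>x\<in>survivors (S - {Min S, y}) H t. g x)
          - expected_sum (S - {Min S, y}) t g))) \<partial>removal_law (S - {Min S, y})) \<partial>?P)"
      by (intro nn_integral_cong, subst nn_integral_cmult[symmetric])
         (auto simp: ennreal_mult'[symmetric] exp_add[symmetric] algebra_simps)
    also have "\<dots> \<le> (\<integral>\<^sup>+y. ennreal (exp (l * ?E y)) * ennreal (exp (4 * l\<^sup>2 * (real (card S) - 2))) \<partial>?P)"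
    proof (intro nn_integral_mono_AE, subst AE_measure_pmf_iff, intro ballI mult_left_mono)
      fix y assume "y \<in> set_pmf ?P"
      then have y: "y \<in> S - {Min S}" by simp
      have "real (card (S - {Min S, y})) = real (card S) - 2" using step(5)[OF y] by simp
      then show "(\<integral>\<^sup>+H. ennreal (exp (l * ((\<Sum>x\<in>survivors (S - {Min S, y}) H t. g x)
          - expected_sum (S - {Min S, y}) t g))) \<partial>removal_law (S - {Min S, y}))
          \<le> ennreal (exp (4 * l\<^sup>2 * (real (card S) - 2)))"
        using step(5)[OF y] step.prems by auto
    qed simp
    also have "\<dots> = (\<integral>\<^sup>+y. ennreal (exp (l * ?E y)) \<partial>?P) * ennreal (exp (4 * l\<^sup>2 * (real (card S) - 2)))"
      by (rule nn_integral_multc) simp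
    also have "\<dots> \<le> ennreal (exp (l\<^sup>2 * 4\<^sup>2 / 2)) * ennreal (exp (4 * l\<^sup>2 * (real (card S) - 2)))"
      using expected_sum_increment[OF step(1,2,3) True, of g] step.prems
      by (intro mult_right_mono hoeffding_pmf mean) auto
    also have "\<dots> = ennreal (exp (4 * l\<^sup>2 * card S))"
      by (simp add: ennreal_mult'[symmetric] exp_add[symmetric] algebra_simps)
    finally show ?thesis .
  qed
qed

lemma expected_sum_uminus: "expected_sum S t (\<lambda>x. - g x) = - expected_sum S t g"
  by (simp add: expected_sum_def sum_negf)

text \<open>Markov's inequality for the exponential moment, at the exponent \<open>l = s / (8 \<bar>S\<bar>)\<close> that
  minimises \<open>4 l\<^sup>2 \<bar>S\<bar> - l s\<close>.\<close>

lemma survivor_sum_upper_tail: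
  assumes "finite S" "even (card S)" "S \<noteq> {}" "\<And>x. x \<in> S \<Longrightarrow> \<bar>g x\<bar> \<le> 1" "0 < s"
  shows "measure_pmf.prob (removal_law S) {H. s \<le> (\<Sum>x\<in>survivors S H t. g x) - expected_sum S t g}
           \<le> exp (- (s\<^sup>2 / (16 * card S)))"
proof -
  define l where "l = s / (8 * card S)"
  have n: "real (card S) > 0" using assms by (simp add: card_gt_0_iff)
  then have l: "l > 0" using assms by (simp add: l_def)
  let ?Y = "\<lambda>H. (\<Sum>x\<in>survivors S H t. g x) - expected_sum S t g"
  have "emeasure (removal_law S) {H. s \<le> ?Y H}
      = (\<integral>\<^sup>+H. indicator {H. s \<le> ?Y H} H \<partial>removal_law S)" by simp
  also have "\<dots> \<le> (\<integral>\<^sup>+H. ennreal (exp (- l * s)) * ennreal (exp (l * ?Y H)) \<partial>removal_law S)"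
    using l by (intro nn_integral_mono)
      (auto simp: indicator_def ennreal_mult'[symmetric] exp_add[symmetric] simp flip: ennreal_1 intro!: ennreal_leI)
  also have "\<dots> = ennreal (exp (- l * s)) * (\<integral>\<^sup>+H. ennreal (exp (l * ?Y H)) \<partial>removal_law S)"
    by (rule nn_integral_cmult) simp
  also have "\<dots> \<le> ennreal (exp (- l * s)) * ennreal (exp (4 * l\<^sup>2 * card S))"
    by (intro mult_left_mono survivor_sum_exp_moment assms l) auto
  also have "\<dots> = ennreal (exp (- l * s + 4 * l\<^sup>2 * card S))"
    by (simp add: ennreal_mult'[symmetric] exp_add[symmetric])
  also have "- l * s + 4 * l\<^sup>2 * card S = - (s\<^sup>2 / (16 * card S))"
    using n by (simp add: l_def power2_eq_square field_simps)
  finally show ?thesis by (simp add: measure_pmf.emeasure_eq_measure)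
qed

lemma survivor_sum_concentration:
  assumes "finite S" "even (card S)" "S \<noteq> {}" "\<And>x. x \<in> S \<Longrightarrow> \<bar>g x\<bar> \<le> 1" "0 < s"
  shows "measure_pmf.prob (removal_law S) {H. s \<le> \<bar>(\<Sum>x\<in>survivors S H t. g x) - expected_sum S t g\<bar>}
           \<le> 2 * exp (- (s\<^sup>2 / (16 * card S)))"
proof -
  let ?A = "\<lambda>g. {H. s \<le> (\<Sum>x\<in>survivors S H t. g x) - expected_sum S t g}"
  have "{H. s \<le> \<bar>(\<Sum>x\<in>survivors S H t. g x) - expected_sum S t g\<bar>} = ?A g \<union> ?A (\<lambda>x. - g x)"
    by (auto simp: expected_sum_uminus sum_negf abs_real_def)
  then have "measure_pmf.prob (removal_law S) {H. s \<le> \<bar>(\<Sum>x\<in>survivors S H t. g x) - expected_sum S t g\<bar>}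
      \<le> measure_pmf.prob (removal_law S) (?A g) + measure_pmf.prob (removal_law S) (?A (\<lambda>x. - g x))"
    by (simp add: measure_Un_le)
  also have "\<dots> \<le> exp (- (s\<^sup>2 / (16 * card S))) + exp (- (s\<^sup>2 / (16 * card S)))"
    by (intro add_mono survivor_sum_upper_tail) (use assms in auto)
  finally show ?thesis by simp
qed


section \<open>The initial profile and its quantiles\<close>

context
  fixes f0 :: "real \<Rightarrow> real"
  assumes f0: "half_line_density f0"
begin

private lemma f0_basic [measurable]: "f0 \<in> borel_measurable borel"
  and f0_nonneg: "\<And>x. 0 \<le> f0 x" and f0_left: "\<And>x. x \<le> 0 \<Longrightarrow> f0 x = 0"
  and f0_integrable: "integrable lborel f0" and f0_mass: "(LBINT x. f0 x) = 1"
  using f0 by (auto simp: half_line_density_def)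

lemma measure_F0:
  assumes [measurable]: "A \<in> sets borel"
  shows "measure (F0_measure f0) A = (LBINT x:A. f0 x)"
proof -
  have "emeasure (F0_measure f0) A = (\<integral>\<^sup>+x. ennreal (indicator A x * f0 x) \<partial>lborel)"
    unfolding F0_measure_def
    by (subst emeasure_density) (auto intro!: nn_integral_cong simp: indicator_def)
  also have "\<dots> = ennreal (LBINT x. indicator A x * f0 x)"
    using f0_nonneg integrable_mult_indicator[OF _ f0_integrable, of A]
    by (intro nn_integral_eq_integral) auto
  finally show ?thesis
    using f0_nonneg by (simp add: measure_def set_lebesgue_integral_def)
qed

lemma real_distribution_F0: "real_distribution (F0_measure f0)"
proof -
  have "emeasure (F0_measure f0) UNIV = (\<integral>\<^sup>+x. ennreal (f0 x) \<partial>lborel)"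
    unfolding F0_measure_def by (subst emeasure_density) auto
  also have "\<dots> = 1"
    using nn_integral_eq_integral[OF f0_integrable] f0_nonneg f0_mass by simp
  finally have "prob_space (F0_measure f0)"
    by (intro prob_spaceI) (simp add: F0_measure_def)
  then show ?thesis
    by (simp add: real_distribution_def real_distribution_axioms_def F0_measure_def)
qed

interpretation F: real_distribution "F0_measure f0"
  by (rule real_distribution_F0)

lemma F0_no_atoms: "measure (F0_measure f0) {x} = 0"
proof -
  have "AE y in lborel. y \<noteq> x" using AE_lborel_singleton[of x] .
  then have "(LBINT y. indicator {x} y *\<^sub>R f0 y) = (LBINT y::real. 0)"
    by (intro integral_cong_AE) (auto elim: eventually_mono)
  then show ?thesis by (simp add: measure_F0 set_lebesgue_integral_def)
qed

lemma F0_left: "measure (F0_measure f0) {..0} = 0"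
proof -
  have "(\<lambda>x. indicator {..0} x *\<^sub>R f0 x) = (\<lambda>x. 0 :: real)"
    using f0_left by (auto simp: indicator_def)
  then show ?thesis by (simp add: measure_F0 set_lebesgue_integral_def)
qed

lemma cdf_F0_zero: "cdf (F0_measure f0) 0 = 0"
  by (simp add: cdf_def F0_left)

lemma F0_cdf_eq_cdf: "0 \<le> x \<Longrightarrow> F0_cdf f0 x = cdf (F0_measure f0) x"
proof -
  assume "0 \<le> x"
  have "measure (F0_measure f0) {..x} = measure (F0_measure f0) ({..<0} \<union> {0..x})"
    using \<open>0 \<le> x\<close> by (intro arg_cong[where f = "measure _"]) auto
  also have "\<dots> = measure (F0_measure f0) {..<0} + measure (F0_measure f0) {0..x}"
    by (intro F.finite_measure_Union) auto
  also have "measure (F0_measure f0) {..<0} = 0"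
    using F.finite_measure_mono[of "{..<0}" "{..0}"] F0_left measure_nonneg[of _ "{..<0::real}"]
    by (simp add: subset_eq order.antisym)
  finally show ?thesis by (simp add: cdf_def measure_F0 F0_cdf_def)
qed

lemma isCont_cdf_F0: "isCont (cdf (F0_measure f0)) x"
  using F.isCont_cdf F0_no_atoms by simp

lemma measure_F0_Ioi: "measure (F0_measure f0) {x<..} = 1 - cdf (F0_measure f0) x"
proof -
  have "measure (F0_measure f0) (UNIV - {..x}) = 1 - measure (F0_measure f0) {..x}"
    using F.prob_compl[of "{..x}"] by simp
  moreover have "UNIV - {..x} = {x<..}" by auto
  ultimately show ?thesis by (simp add: cdf_def)
qed

lemma measure_F0_Ioc: "a \<le> b \<Longrightarrow> measure (F0_measure f0) {a<..b} = cdf (F0_measure f0) b - cdf (F0_measure f0) a"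
  using F.cdf_diff_eq[of a b] by (cases "a = b") auto

lemma measure_F0_Icc: "a \<le> b \<Longrightarrow> measure (F0_measure f0) {a..b} = cdf (F0_measure f0) b - cdf (F0_measure f0) a"
proof -
  assume "a \<le> b"
  have "{a..b} = {a} \<union> {a<..b}" using \<open>a \<le> b\<close> by auto
  then show ?thesis
    using F.finite_measure_Union[of "{a}" "{a<..b}"] F0_no_atoms[of a] measure_F0_Ioc[OF \<open>a \<le> b\<close>] by simp
qed

lemma rho_eq: "rho f0 t = 1 - cdf (F0_measure f0) t"
proof -
  have "{t..} = {t} \<union> {t<..}" by auto
  then have "measure (F0_measure f0) {t..} = 1 - cdf (F0_measure f0) t"
    using F.finite_measure_Union[of "{t}" "{t<..}"] F0_no_atoms[of t] measure_F0_Ioi[of t] by simp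
  then show ?thesis by (simp add: rho_def measure_F0)
qed

lemma measure_F0_Ioi_rho: "measure (F0_measure f0) {t<..} = rho f0 t"
  by (simp add: measure_F0_Ioi rho_eq)

lemma rho_bounds: "0 \<le> rho f0 t" "rho f0 t \<le> 1"
  using measure_F0_Ioi_rho[of t] F.prob_le_1[of "{t<..}"] by (metis measure_nonneg, simp)

lemma rho_tendsto_0: "(rho f0 \<longlongrightarrow> 0) at_top"
  using tendsto_diff[OF tendsto_const[of 1] F.cdf_lim_at_top_prob] by (simp add: rho_eq[abs_def])

lemma modulus_bound:
  assumes "0 \<le> x" "0 \<le> y" "\<bar>x - y\<bar> \<le> \<delta>"
  shows "\<bar>rho f0 x - rho f0 y\<bar> \<le> F0_modulus f0 \<delta>"
proof -
  let ?h = "\<lambda>(x, y). \<bar>F0_cdf f0 x - F0_cdf f0 y\<bar>"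
  let ?D = "{(x, y). 0 \<le> x \<and> 0 \<le> y \<and> \<bar>x - y\<bar> \<le> \<delta>}"
  have "\<bar>F0_cdf f0 x - F0_cdf f0 y\<bar> \<le> 1" if "0 \<le> x" "0 \<le> y" for x y
    using that rho_bounds[of x] rho_bounds[of y] by (auto simp: F0_cdf_eq_cdf rho_eq)
  then have "bdd_above (?h ` ?D)" by (auto intro!: bdd_aboveI[of _ 1])
  then have "?h (x, y) \<le> (SUP z\<in>?D. ?h z)" by (intro cSUP_upper) (use assms in auto)
  then show ?thesis using assms by (simp add: F0_modulus_def F0_cdf_eq_cdf rho_eq abs_minus_commute)
qed

text \<open>The distribution function is uniformly continuous: on a compact interval because it is
  continuous, and beyond it because the remaining mass, and with it every increment, is small.\<close>

lemma modulus_small: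
  assumes "0 < \<eta>"
  obtains \<delta> where "0 < \<delta>" "\<And>d. 0 \<le> d \<Longrightarrow> d \<le> \<delta> \<Longrightarrow> F0_modulus f0 d \<le> \<eta>"
proof -
  obtain L where L: "0 \<le> L" "\<And>x. L \<le> x \<Longrightarrow> rho f0 x < \<eta>"
  proof -
    have "eventually (\<lambda>x. rho f0 x < \<eta>) at_top"
      using order_tendstoD(2)[OF rho_tendsto_0 assms] .
    then obtain L where "\<forall>x\<ge>L. rho f0 x < \<eta>" by (auto simp: eventually_at_top_linorder)
    then show ?thesis using that[of "max 0 L"] by auto
  qed
  have "uniformly_continuous_on {0..L+1} (cdf (F0_measure f0))"
    using isCont_cdf_F0 by (intro compact_uniformly_continuous continuous_at_imp_continuous_on) auto
  then obtain d0 where d0: "0 < d0" "\<And>x y. x \<in> {0..L+1} \<Longrightarrow> y \<in> {0..L+1} \<Longrightarrow> dist y x < d0 \<Longrightarrow>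
      dist (cdf (F0_measure f0) y) (cdf (F0_measure f0) x) < \<eta>"
    unfolding uniformly_continuous_on_def using assms by metis
  show ?thesis
  proof (rule that[of "min 1 (d0 / 2)"])
    fix d assume d: "0 \<le> d" "d \<le> min 1 (d0 / 2)"
    have "\<bar>F0_cdf f0 x - F0_cdf f0 y\<bar> \<le> \<eta>" if xy: "0 \<le> x" "0 \<le> y" "\<bar>x - y\<bar> \<le> d" for x y
    proof (cases "x \<le> L + 1 \<and> y \<le> L + 1")
      case True
      then show ?thesis using d0(2)[of y x] xy d d0(1)
        by (simp add: F0_cdf_eq_cdf dist_real_def)
    next
      case False
      then have "L \<le> x" "L \<le> y" using xy d by auto
      then show ?thesis using L(2)[of x] L(2)[of y] xy rho_bounds[of x] rho_bounds[of y]
        by (simp add: F0_cdf_eq_cdf rho_eq)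
    qed
    then show "F0_modulus f0 d \<le> \<eta>"
      unfolding F0_modulus_def by (intro cSUP_least) (use d in \<open>auto intro!: exI[of _ 0]\<close>)
  qed (use d0 in auto)
qed

context
  fixes n :: nat
  assumes n: "0 < n"
begin

text \<open>The Galois connection between a distribution function and its generalised inverse: by continuity
  the infimum defining the quantile is attained. It turns counting the particles in an
  interval into counting the integers \<open>k\<close> with \<open>(2 k - 1) / (2 n)\<close> below a level.\<close>

lemma start_le_iff:
  assumes k: "1 \<le> k" "k \<le> n" and x: "0 \<le> x"
  shows "start f0 n k \<le> x \<longleftrightarrow> (2 * real k - 1) / (2 * real n) \<le> cdf (F0_measure f0) x"
proof -
  define u where "u = (2 * real k - 1) / (2 * real n)"
  define Q where "Q = {x. 0 \<le> x \<and> u \<le> cdf (F0_measure f0) x}"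
  have "u < 1" using k n by (simp add: u_def field_simps)
  then have "eventually (\<lambda>x. u < cdf (F0_measure f0) x) at_top"
    using order_tendstoD(1)[OF F.cdf_lim_at_top_prob] by simp
  then obtain L where "\<forall>x\<ge>L. u < cdf (F0_measure f0) x" by (auto simp: eventually_at_top_linorder)
  then have "max 0 L \<in> Q" unfolding Q_def by (auto intro!: less_imp_le)
  then have ne: "Q \<noteq> {}" by auto
  have bdd: "bdd_below Q" by (auto simp: Q_def intro!: bdd_belowI[of _ 0])
  have "closed Q"
    unfolding Q_def using isCont_cdf_F0
    by (intro closed_Collect_conj closed_Collect_le continuous_intros) (auto intro: continuous_at_imp_continuous_on)
  then have "Inf Q \<in> Q" using closed_contains_Inf[OF ne bdd] by simp
  then have InfQ: "u \<le> cdf (F0_measure f0) (Inf Q)" by (simp add: Q_def)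
  have "start f0 n k = Inf Q"
    unfolding start_def F0_inverse_def Q_def u_def by (auto intro!: arg_cong[where f = Inf] simp: F0_cdf_eq_cdf)
  moreover have "Inf Q \<le> x \<longleftrightarrow> u \<le> cdf (F0_measure f0) x"
  proof
    assume "Inf Q \<le> x"
    then show "u \<le> cdf (F0_measure f0) x" using InfQ F.cdf_nondecreasing[of "Inf Q" x] by linarith
  next
    assume "u \<le> cdf (F0_measure f0) x"
    then show "Inf Q \<le> x" using x bdd by (intro cInf_lower) (auto simp: Q_def)
  qed
  ultimately show ?thesis by (simp add: u_def)
qed

lemma inj_on_start: "inj_on (start f0 n) {1..n}"
proof (rule linorder_inj_onI)
  fix k l assume kl: "k < l" "k \<in> {1..n}" "l \<in> {1..n}"
  define u where "u k = (2 * real k - 1) / (2 * real n)" for k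
  have u: "0 \<le> u k" "u k < u l" "u l < 1" using kl n by (auto simp: u_def field_simps)
  have "eventually (\<lambda>x. u k < cdf (F0_measure f0) x) at_top"
    using order_tendstoD(1)[OF F.cdf_lim_at_top_prob] u by simp
  then obtain L where "\<forall>x\<ge>L. u k < cdf (F0_measure f0) x" by (auto simp: eventually_at_top_linorder)
  then have "u k \<le> cdf (F0_measure f0) (max 0 L)" by (simp add: less_imp_le)
  then obtain x where x: "0 \<le> x" "cdf (F0_measure f0) x = u k"
    using IVT[of "cdf (F0_measure f0)" 0 "u k" "max 0 L"] isCont_cdf_F0 u cdf_F0_zero by auto
  have "start f0 n k \<le> x" "\<not> start f0 n l \<le> x"
    using start_le_iff[of k x] start_le_iff[of l x] kl x u by (auto simp: u_def)
  then show "start f0 n k \<noteq> start f0 n l" by auto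
qed auto

lemma card_start: "card (start f0 n ` {1..n}) = n"
  using card_image[OF inj_on_start] by simp

lemma count_start_le:
  assumes "0 \<le> x"
  shows "\<bar>real (card (start f0 n ` {1..n} \<inter> {..x})) / n - cdf (F0_measure f0) x\<bar> \<le> 1 / n"
proof -
  define v where "v = cdf (F0_measure f0) x"
  have v: "0 \<le> v" "v \<le> 1" using rho_bounds[of x] by (auto simp: v_def rho_eq)
  have "n * v + 1/2 < n + 1" 
  proof -
    have "real n * v \<le> real n * 1" using v by (intro mult_left_mono) auto
    then show ?thesis by linarith
  qed
  \<comment> \<open>The quantile levels sit in the middle of their cells of mass \<open>1 / n\<close>, hence the shift by one half.\<close>
  have le_iff: "(2 * real k - 1) / (2 * real n) \<le> v \<longleftrightarrow> int k \<le> \<lfloor>n * v + 1/2\<rfloor>" for k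
    using n by (simp add: le_floor_iff field_simps)
  have "start f0 n ` {1..n} \<inter> {..x} = start f0 n ` {k \<in> {1..n}. start f0 n k \<le> x}" by auto
  also have "{k \<in> {1..n}. start f0 n k \<le> x} = {1..nat \<lfloor>n * v + 1/2\<rfloor>}"
  proof -
    have "start f0 n k \<le> x \<longleftrightarrow> int k \<le> \<lfloor>n * v + 1/2\<rfloor>" if "k \<in> {1..n}" for k
      using start_le_iff[of k x] that assms le_iff[of k] by (simp add: v_def)
    moreover have "\<lfloor>n * v + 1/2\<rfloor> \<le> n" using \<open>n * v + 1/2 < n + 1\<close> by (simp add: floor_le_iff)
    ultimately show ?thesis by (auto simp: le_nat_iff)
  qed
  also have "card (start f0 n ` {1..nat \<lfloor>n * v + 1/2\<rfloor>}) = nat \<lfloor>n * v + 1/2\<rfloor>"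
  proof -
    have "{1..nat \<lfloor>n * v + 1/2\<rfloor>} \<subseteq> {1..n}"
      using \<open>n * v + 1/2 < n + 1\<close> by (auto simp: floor_le_iff nat_le_iff)
    then show ?thesis using card_image[OF inj_on_subset[OF inj_on_start]] by simp
  qed
  finally have "real (card (start f0 n ` {1..n} \<inter> {..x})) = of_int \<lfloor>n * v + 1/2\<rfloor>"
    using v by simp
  then have "\<bar>real (card (start f0 n ` {1..n} \<inter> {..x})) - n * v\<bar> \<le> 1" by linarith
  then have "\<bar>real (card (start f0 n ` {1..n} \<inter> {..x})) - n * v\<bar> / n \<le> 1 / n"
    by (rule divide_right_mono) simp
  moreover have "\<bar>real (card (start f0 n ` {1..n} \<inter> {..x})) - n * v\<bar> / n
      = \<bar>(real (card (start f0 n ` {1..n} \<inter> {..x})) - n * v) / n\<bar>" by (simp add: abs_divide)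
  ultimately show ?thesis using n by (simp add: diff_divide_distrib v_def)
qed

end

lemma count_start_le_tendsto:
  assumes "0 \<le> x"
  shows "(\<lambda>n. real (card (start f0 n ` {1..n} \<inter> {..x})) / n) \<longlonglongrightarrow> cdf (F0_measure f0) x"
proof (rule LIM_zero_cancel, rule Lim_null_comparison)
  show "eventually (\<lambda>n. norm (real (card (start f0 n ` {1..n} \<inter> {..x})) / n - cdf (F0_measure f0) x) \<le> 1 / real n) sequentially"
    using eventually_gt_at_top[of 0] by eventually_elim (use count_start_le[OF _ assms] in simp)
  show "(\<lambda>n. 1 / real n) \<longlonglongrightarrow> 0" by (rule lim_1_over_n)
qed

lemma count_start_Ioc_tendsto:
  assumes "0 \<le> a" "a \<le> b"
  shows "(\<lambda>n. real (card (start f0 n ` {1..n} \<inter> {a<..b})) / n) \<longlonglongrightarrow> measure (F0_measure f0) {a<..b}"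
proof -
  have "card (A \<inter> {..b}) = card (A \<inter> {..a}) + card (A \<inter> {a<..b})" if "finite A" for A :: "real set"
    using that assms by (subst card_Un_disjoint[symmetric]) (auto intro!: arg_cong[where f = card])
  then have "real (card (start f0 n ` {1..n} \<inter> {a<..b})) / n
      = real (card (start f0 n ` {1..n} \<inter> {..b})) / n - real (card (start f0 n ` {1..n} \<inter> {..a})) / n" for n
    by (simp add: add_divide_distrib)
  then show ?thesis
    using tendsto_diff[OF count_start_le_tendsto count_start_le_tendsto, of b a] assms
    by (simp add: measure_F0_Ioc)
qed

lemma count_start_Ioi_tendsto:
  assumes "0 \<le> a"
  shows "(\<lambda>n. real (card (start f0 n ` {1..n} \<inter> {a<..})) / n) \<longlonglongrightarrow> measure (F0_measure f0) {a<..}"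
proof -
  have "card A = card (A \<inter> {..a}) + card (A \<inter> {a<..})" if "finite A" for A :: "real set"
    using that assms by (subst card_Un_disjoint[symmetric]) (auto intro!: arg_cong[where f = card])
  from this[of "start f0 n ` {1..n}" for n]
  have "real (card (start f0 n ` {1..n} \<inter> {a<..})) / n
      = 1 - real (card (start f0 n ` {1..n} \<inter> {..a})) / n" if "0 < n" for n
    using card_start[OF that] that by (simp add: field_simps)
  then have "eventually (\<lambda>n. 1 - real (card (start f0 n ` {1..n} \<inter> {..a})) / n
      = real (card (start f0 n ` {1..n} \<inter> {a<..})) / n) sequentially"
    by (intro eventually_mono[OF eventually_gt_at_top[of 0]]) simp
  then show ?thesis
    using tendsto_diff[OF tendsto_const[of 1] count_start_le_tendsto[OF assms]]
    by (simp add: measure_F0_Ioi tendsto_cong)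
qed

end


section \<open>Testing against step functions\<close>

text \<open>The half-line beyond \<open>\<tau>\<close>, cut into \<open>p\<close> intervals of length \<open>\<delta>\<close> and, as cell number \<open>p\<close>, the
  remaining tail. The cells move with \<open>\<tau>\<close>: so their number depends on the precision and the tail
  of the profile, and not on the time horizon.\<close>

definition cell :: "real \<Rightarrow> real \<Rightarrow> nat \<Rightarrow> nat \<Rightarrow> real set" where
  "cell \<tau> \<delta> p j = (if j < p then {\<tau> + j * \<delta><..\<tau> + (j + 1) * \<delta>} else {\<tau> + p * \<delta><..})"

lemma cell_borel [measurable]: "cell \<tau> \<delta> p j \<in> sets borel"
  by (simp add: cell_def)

lemma cell_gt: "0 < \<delta> \<Longrightarrow> cell \<tau> \<delta> p j \<subseteq> {\<tau><..}"
proof -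
  assume "0 < \<delta>"
  then have "0 \<le> j * \<delta>" "0 \<le> p * \<delta>" by simp_all
  then show ?thesis by (auto simp: cell_def simp del: zero_le_mult_iff)
qed

lemma disjoint_family_on_cell:
  assumes "0 < \<delta>"
  shows "disjoint_family_on (cell \<tau> \<delta> p) {..p}"
proof -
  have "cell \<tau> \<delta> p j \<inter> cell \<tau> \<delta> p k = {}" if "j < k" "k \<le> p" for j k
  proof -
    have "real (j + 1) * \<delta> \<le> real k * \<delta>"
      using that assms by (intro mult_right_mono) auto
    moreover have "x \<le> \<tau> + real (j + 1) * \<delta>" if "x \<in> cell \<tau> \<delta> p j" for x
      using that \<open>j < k\<close> \<open>k \<le> p\<close> by (simp add: cell_def add.commute)
    moreover have "\<tau> + real k * \<delta> < x" if "x \<in> cell \<tau> \<delta> p k" for x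
      using that \<open>k \<le> p\<close> by (simp add: cell_def split: if_splits)
    ultimately show ?thesis by fastforce
  qed
  then show ?thesis
    unfolding disjoint_family_on_def by (metis Int_commute atMost_iff linorder_neqE_nat)
qed

lemma in_some_cell:
  assumes "0 < \<delta>" "\<tau> < x"
  obtains j where "j \<le> p" "x \<in> cell \<tau> \<delta> p j"
proof (cases "\<tau> + p * \<delta> < x")
  case True
  then show ?thesis using that[of p] by (simp add: cell_def)
next
  case False
  define k where "k = nat \<lceil>(x - \<tau>) / \<delta>\<rceil>"
  have pos: "0 < (x - \<tau>) / \<delta>" using assms by simp
  have k: "real k - 1 < (x - \<tau>) / \<delta>" "(x - \<tau>) / \<delta> \<le> real k" "0 < k"
    using pos unfolding k_def by linarith+
  have "(x - \<tau>) / \<delta> \<le> p" using False assms by (simp add: field_simps)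
  with k have "k - 1 < p" by linarith
  moreover have "x \<in> cell \<tau> \<delta> p (k - 1)"
    using k assms \<open>k - 1 < p\<close> by (simp add: cell_def field_simps of_nat_diff)
  ultimately show ?thesis using that[of "k - 1"] by simp
qed

lemma Union_cells:
  assumes "0 < \<delta>"
  shows "(\<Union>j\<le>p. cell \<tau> \<delta> p j) = {\<tau><..}"
proof
  show "(\<Union>j\<le>p. cell \<tau> \<delta> p j) \<subseteq> {\<tau><..}"
    by (rule UN_least) (rule cell_gt[OF assms])
  show "{\<tau><..} \<subseteq> (\<Union>j\<le>p. cell \<tau> \<delta> p j)"
  proof
    fix x assume "x \<in> {\<tau><..}"
    then obtain j where "j \<le> p" "x \<in> cell \<tau> \<delta> p j"
      using in_some_cell[OF assms, of \<tau> x p] by auto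
    then show "x \<in> (\<Union>j\<le>p. cell \<tau> \<delta> p j)" by blast
  qed
qed

lemma card_Int_Union_cells:
  assumes "0 < \<delta>" "U \<subseteq> {..p}" "finite A"
  shows "card (A \<inter> (\<Union>j\<in>U. cell \<tau> \<delta> p j)) = (\<Sum>j\<in>U. card (A \<inter> cell \<tau> \<delta> p j))"
proof -
  have "A \<inter> (\<Union>j\<in>U. cell \<tau> \<delta> p j) = (\<Union>j\<in>U. A \<inter> cell \<tau> \<delta> p j)" by auto
  moreover have "card (\<Union>j\<in>U. A \<inter> cell \<tau> \<delta> p j) = (\<Sum>j\<in>U. card (A \<inter> cell \<tau> \<delta> p j))"
  proof (rule card_UN_disjoint)
    show "\<forall>i\<in>U. \<forall>j\<in>U. i \<noteq> j \<longrightarrow> A \<inter> cell \<tau> \<delta> p i \<inter> (A \<inter> cell \<tau> \<delta> p j) = {}"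
      using disjoint_family_on_mono[OF assms(2) disjoint_family_on_cell[OF assms(1), of \<tau> p]]
      unfolding disjoint_family_on_def by blast
  qed (use assms in \<open>auto intro: finite_subset\<close>)
  ultimately show ?thesis by simp
qed

lemma (in real_distribution) measure_Union_cells:
  assumes "0 < \<delta>" "U \<subseteq> {..p}"
  shows "measure M (\<Union>j\<in>U. cell \<tau> \<delta> p j) = (\<Sum>j\<in>U. measure M (cell \<tau> \<delta> p j))"
  using disjoint_family_on_mono[OF assms(2) disjoint_family_on_cell[OF assms(1)]] assms
  by (intro finite_measure_finite_Union) (auto intro: finite_subset)

lemma (in real_distribution) set_integral_bound:
  fixes \<psi> :: "real \<Rightarrow> real"
  assumes [measurable]: "B \<in> sets borel" "\<psi> \<in> borel_measurable borel" and b: "\<And>x. x \<in> B \<Longrightarrow> \<bar>\<psi> x\<bar> \<le> 1"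
  shows "set_integrable M B \<psi>" "\<bar>LINT x:B|M. \<psi> x\<bar> \<le> measure M B"
proof -
  have ind: "integrable M (indicator B :: real \<Rightarrow> real)"
    by (intro integrable_real_indicator) (auto simp: less_top[symmetric])
  show *: "set_integrable M B \<psi>" unfolding set_integrable_def
    by (rule Bochner_Integration.integrable_bound[OF ind]) (use b in \<open>auto simp: indicator_def\<close>)
  have "\<bar>LINT x:B|M. \<psi> x\<bar> \<le> (LINT x|M. \<bar>indicator B x *\<^sub>R \<psi> x\<bar>)"
    unfolding set_lebesgue_integral_def using integral_norm_bound[of M "\<lambda>x. indicator B x *\<^sub>R \<psi> x"] by simp
  also have "\<dots> \<le> (LINT x|M. indicator B x)"
    by (intro integral_mono ind integrable_abs *[unfolded set_integrable_def]) (use b in \<open>auto simp: indicator_def\<close>)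
  finally show "\<bar>LINT x:B|M. \<psi> x\<bar> \<le> measure M B" by simp
qed

lemma sum_indicator_card: "finite W \<Longrightarrow> (\<Sum>x\<in>W. indicator B x) = real (card (W \<inter> B))"
  by (simp add: indicator_def of_bool_def sum.inter_restrict[symmetric])

lemma sum_abs_le_subset_sums:
  fixes d :: "'a \<Rightarrow> real"
  assumes "finite I" "\<And>U. U \<subseteq> I \<Longrightarrow> \<bar>\<Sum>j\<in>U. d j\<bar> \<le> D"
  shows "(\<Sum>j\<in>I. \<bar>d j\<bar>) \<le> 2 * D"
proof -
  have "(\<Sum>j\<in>I. \<bar>d j\<bar>) = (\<Sum>j\<in>{j\<in>I. 0 \<le> d j}. \<bar>d j\<bar>) + (\<Sum>j\<in>{j\<in>I. \<not> 0 \<le> d j}. \<bar>d j\<bar>)"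
    using assms(1) by (subst sum.union_disjoint[symmetric]) (auto intro!: sum.cong)
  also have "(\<Sum>j\<in>{j\<in>I. 0 \<le> d j}. \<bar>d j\<bar>) = (\<Sum>j\<in>{j\<in>I. 0 \<le> d j}. d j)"
    by (intro sum.cong) auto
  also have "(\<Sum>j\<in>{j\<in>I. \<not> 0 \<le> d j}. \<bar>d j\<bar>) = - (\<Sum>j\<in>{j\<in>I. \<not> 0 \<le> d j}. d j)"
    by (subst sum_negf[symmetric], intro sum.cong) auto
  finally show ?thesis
    using assms(2)[of "{j\<in>I. 0 \<le> d j}"] assms(2)[of "{j\<in>I. \<not> 0 \<le> d j}"] by (simp add: abs_le_iff)
qed

text \<open>Collecting the cells with positive and those with negative difference into one union each
  shows that the absolute differences over the single cells add up to at most \<open>2 D\<close>. As this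
  holds however many cells there are, the precision \<open>D\<close> required from the concentration bound is
  a fixed multiple of the target error: it is what makes the exponential rate universal. The test
  function is replaced by the step function that takes its value at the left end of each bounded
  cell, at the cost \<open>\<delta>\<close>, and zero on the tail, at the cost of the tail mass.\<close>

lemma (in real_distribution) close_on_cells_imp_close:
  fixes W :: "real set" and \<psi> :: "real \<Rightarrow> real"
  assumes W: "finite W" "W \<subseteq> {\<tau><..}" "card W \<le> n" and n: "0 < n"
    and r: "0 \<le> r" "r \<le> 1" and \<delta>: "0 < \<delta>"
    and D: "\<And>U. U \<subseteq> {..p} \<Longrightarrow>
      \<bar>card (W \<inter> (\<Union>j\<in>U. cell \<tau> \<delta> p j)) / n - r * measure M (\<Union>j\<in>U. cell \<tau> \<delta> p j)\<bar> \<le> D"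
    and tail: "measure M {\<tau> + p * \<delta><..} \<le> \<eta>"
    and \<psi>: "\<And>x. \<bar>\<psi> x\<bar> \<le> 1" "\<And>x y. \<bar>\<psi> x - \<psi> y\<bar> \<le> \<bar>x - y\<bar>"
    and [measurable]: "\<psi> \<in> borel_measurable borel"
  shows "\<bar>(\<Sum>x\<in>W. \<psi> x) / n - r * (LINT x:{\<tau><..}|M. \<psi> x)\<bar> \<le> 2 * \<delta> + 2 * \<eta> + 3 * D"
proof -
  let ?C = "cell \<tau> \<delta> p"
  define h where "h x = (\<Sum>j<p. \<psi> (\<tau> + j * \<delta>) * indicator (?C j) x)" for x
  have h_cell: "h x = (if j < p then \<psi> (\<tau> + j * \<delta>) else 0)" if "j \<le> p" "x \<in> ?C j" for x j
  proof -
    have "indicator (?C k) x = (if k = j then 1 else 0 :: real)" if "k \<le> p" for k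
      using \<open>x \<in> ?C j\<close> \<open>j \<le> p\<close> that disjoint_family_on_cell[OF \<delta>, of \<tau> p]
      by (auto simp: disjoint_family_on_def indicator_def)
    then have "h x = (\<Sum>k<p. if k = j then \<psi> (\<tau> + j * \<delta>) else 0)"
      unfolding h_def by (intro sum.cong) auto
    then show ?thesis by (simp add: sum.delta)
  qed
  have h_close: "\<bar>\<psi> x - h x\<bar> \<le> \<delta> + indicator (?C p) x" if x: "\<tau> < x" for x
  proof -
    obtain j where j: "j \<le> p" "x \<in> ?C j" using in_some_cell[OF \<delta> x] .
    show ?thesis
    proof (cases "j < p")
      case True
      then have "\<bar>x - (\<tau> + j * \<delta>)\<bar> \<le> \<delta>" using j by (auto simp: cell_def algebra_simps)
      then have "\<bar>\<psi> x - \<psi> (\<tau> + j * \<delta>)\<bar> \<le> \<delta>" using \<psi>(2) order_trans by blast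
      then show ?thesis using h_cell[OF j] True by (simp add: indicator_def)
    next
      case False
      then show ?thesis using h_cell[OF j] j \<psi>(1)[of x] \<delta> by (simp add: indicator_def)
    qed
  qed
  have DpW: "card (W \<inter> ?C p) / n \<le> r * measure M (?C p) + D"
    using D[of "{p}"] by (simp add: abs_le_iff)
  have tail': "measure M (?C p) \<le> \<eta>" using tail by (simp add: cell_def)
  have r_tail: "r * measure M (?C p) \<le> \<eta>" using r tail' mult_mono[of r 1 "measure M (?C p)" \<eta>] by simp

  have "\<bar>(\<Sum>x\<in>W. \<psi> x) - (\<Sum>x\<in>W. h x)\<bar> \<le> (\<Sum>x\<in>W. \<bar>\<psi> x - h x\<bar>)"
    unfolding sum_subtractf[symmetric] by (rule sum_abs)
  also have "\<dots> \<le> (\<Sum>x\<in>W. \<delta> + indicator (?C p) x)"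
    using W by (intro sum_mono h_close) auto
  also have "\<dots> = card W * \<delta> + card (W \<inter> ?C p)"
    using W by (simp add: sum.distrib sum_indicator_card)
  also have "\<dots> \<le> n * \<delta> + card (W \<inter> ?C p)" using W \<delta> by simp
  finally have "\<bar>(\<Sum>x\<in>W. \<psi> x) - (\<Sum>x\<in>W. h x)\<bar> / n \<le> (n * \<delta> + card (W \<inter> ?C p)) / n"
    using n by (intro divide_right_mono) auto
  also have "\<dots> = \<delta> + card (W \<inter> ?C p) / n" using n by (simp add: add_divide_distrib)
  finally have 1: "\<bar>(\<Sum>x\<in>W. \<psi> x) / n - (\<Sum>x\<in>W. h x) / n\<bar> \<le> \<delta> + \<eta> + D"
    using DpW r_tail by (simp flip: diff_divide_distrib add: abs_divide)

  have [measurable]: "h \<in> borel_measurable borel" unfolding h_def by measurable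
  have h_out: "h x = 0" if "\<not> \<tau> < x" for x
    unfolding h_def using that cell_gt[OF \<delta>, of \<tau> p] by (intro sum.neutral) (auto simp: indicator_def)
  have ind_int: "integrable M (indicator (?C j) :: real \<Rightarrow> real)" for j
    by (intro integrable_real_indicator) (auto simp: less_top[symmetric])
  have h_int: "integrable M h" unfolding h_def
    by (intro Bochner_Integration.integrable_sum integrable_mult_right ind_int)
  have int_h: "(LINT x|M. h x) = (\<Sum>j<p. \<psi> (\<tau> + j * \<delta>) * measure M (?C j))"
    unfolding h_def using ind_int by (subst Bochner_Integration.integral_sum) auto
  have \<psi>_int: "integrable M (\<lambda>x. indicator {\<tau><..} x *\<^sub>R \<psi> x)"
    using set_integral_bound(1)[of "{\<tau><..}" \<psi>] \<psi> by (simp add: set_integrable_def)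
  have "\<bar>(LINT x:{\<tau><..}|M. \<psi> x) - (LINT x|M. h x)\<bar> = \<bar>LINT x|M. indicator {\<tau><..} x *\<^sub>R \<psi> x - h x\<bar>"
    unfolding set_lebesgue_integral_def using \<psi>_int h_int by simp
  also have "\<dots> \<le> (LINT x|M. \<bar>indicator {\<tau><..} x *\<^sub>R \<psi> x - h x\<bar>)"
    using integral_norm_bound[of M "\<lambda>x. indicator {\<tau><..} x *\<^sub>R \<psi> x - h x"] by simp
  also have "\<dots> \<le> (LINT x|M. \<delta> + indicator (?C p) x)"
  proof (rule integral_mono)
    fix x show "\<bar>indicator {\<tau><..} x *\<^sub>R \<psi> x - h x\<bar> \<le> \<delta> + indicator (?C p) x"
      using h_close[of x] h_out[of x] \<delta> by (cases "\<tau> < x") (auto simp: indicator_def)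
  qed (use \<psi>_int h_int ind_int in auto)
  also have "\<dots> = \<delta> + measure M (?C p)" using prob_space ind_int[of p] by simp
  also have "\<dots> \<le> \<delta> + \<eta>" using tail' by simp
  finally have "r * \<bar>(LINT x:{\<tau><..}|M. \<psi> x) - (LINT x|M. h x)\<bar> \<le> 1 * (\<delta> + \<eta>)"
    using r by (intro mult_mono) auto
  then have 2: "\<bar>r * (LINT x:{\<tau><..}|M. \<psi> x) - r * (LINT x|M. h x)\<bar> \<le> \<delta> + \<eta>"
    using r by (simp flip: right_diff_distrib add: abs_mult)

  define d where "d j = card (W \<inter> ?C j) / n - r * measure M (?C j)" for j
  have "(\<Sum>x\<in>W. h x) = (\<Sum>j<p. \<psi> (\<tau> + j * \<delta>) * card (W \<inter> ?C j))"
    unfolding h_def using W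
    by (subst sum.swap) (simp add: sum_distrib_left[symmetric] sum_indicator_card)
  then have "(\<Sum>x\<in>W. h x) / n - r * (LINT x|M. h x) = (\<Sum>j<p. \<psi> (\<tau> + j * \<delta>) * d j)"
    unfolding int_h d_def
    by (simp add: sum_divide_distrib sum_distrib_left sum_subtractf[symmetric] algebra_simps)
  also have "\<bar>\<dots>\<bar> \<le> (\<Sum>j<p. \<bar>d j\<bar>)"
  proof (rule order_trans[OF sum_abs sum_mono])
    fix j show "\<bar>\<psi> (\<tau> + j * \<delta>) * d j\<bar> \<le> \<bar>d j\<bar>"
      using \<psi>(1)[of "\<tau> + j * \<delta>"] mult_right_mono[of "\<bar>\<psi> (\<tau> + j * \<delta>)\<bar>" 1 "\<bar>d j\<bar>"] by (simp add: abs_mult)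
  qed
  also have "\<dots> \<le> 2 * D"
  proof (rule sum_abs_le_subset_sums)
    fix U assume "U \<subseteq> {..<p}"
    then have U: "U \<subseteq> {..p}" by auto
    have "(\<Sum>j\<in>U. d j) = card (W \<inter> (\<Union>j\<in>U. ?C j)) / n - r * measure M (\<Union>j\<in>U. ?C j)"
      unfolding d_def
      by (simp add: card_Int_Union_cells[OF \<delta> U W(1)] measure_Union_cells[OF \<delta> U]
          sum_subtractf sum_divide_distrib sum_distrib_left)
    then show "\<bar>\<Sum>j\<in>U. d j\<bar> \<le> D" using D[OF U] by simp
  qed simp
  finally show ?thesis using 1 2 by linarith
qed


section \<open>The bounded Lipschitz distance\<close>

lemma integral_scale_measure:
  fixes f :: "'a \<Rightarrow> real"
  assumes "0 \<le> c" "f \<in> borel_measurable M"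
  shows "(LINT x|scale_measure (ennreal c) M. f x) = c * (LINT x|M. f x)"
proof -
  have "scale_measure (ennreal c) M = density M (\<lambda>_. ennreal c)"
    by (rule measure_eqI) (auto simp: emeasure_density_const)
  then show ?thesis using assms by (simp add: integral_density)
qed

lemma bl_norm_le_1D:
  assumes "bl_norm \<phi> \<le> 1"
  shows "\<And>x. 0 \<le> x \<Longrightarrow> \<bar>\<phi> x\<bar> \<le> 1"
    and "\<And>x y. 0 \<le> x \<Longrightarrow> 0 \<le> y \<Longrightarrow> \<bar>\<phi> x - \<phi> y\<bar> \<le> \<bar>x - y\<bar>"
proof -
  define P :: ereal where "P = (SUP x \<in> {0..}. ereal \<bar>\<phi> x\<bar>)"
  define L :: ereal where
    "L = (SUP (x, y) \<in> {(x, y). 0 \<le> x \<and> 0 \<le> y \<and> x \<noteq> y}. ereal (\<bar>\<phi> x - \<phi> y\<bar> / \<bar>x - y\<bar>))"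
  have P: "ereal \<bar>\<phi> x\<bar> \<le> P" if "0 \<le> x" for x
    unfolding P_def using that by (intro SUP_upper) auto
  have L: "ereal (\<bar>\<phi> x - \<phi> y\<bar> / \<bar>x - y\<bar>) \<le> L" if "0 \<le> x" "0 \<le> y" "x \<noteq> y" for x y
    unfolding L_def using that by (intro SUP_upper2[of "(x, y)"]) auto
  have "0 \<le> P" using order_trans[OF _ P[of 0]] by simp
  have "0 \<le> L" using order_trans[OF _ L[of 0 1]] by simp
  have "P + L \<le> 1" using assms by (simp add: bl_norm_def P_def L_def)
  then have "P \<le> 1" "L \<le> 1"
    using \<open>0 \<le> P\<close> \<open>0 \<le> L\<close> by (metis add.right_neutral add_left_mono order_trans, metis add.left_neutral add_right_mono order_trans)
  show "\<bar>\<phi> x\<bar> \<le> 1" if "0 \<le> x" for x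
    using order_trans[OF P[OF that] \<open>P \<le> 1\<close>] by simp
  show "\<bar>\<phi> x - \<phi> y\<bar> \<le> \<bar>x - y\<bar>" if "0 \<le> x" "0 \<le> y" for x y
  proof (cases "x = y")
    case False
    then show ?thesis using order_trans[OF L[OF that False] \<open>L \<le> 1\<close>] by (simp add: divide_le_eq)
  qed simp
qed

lemma continuous_on_of_bl_norm:
  assumes "bl_norm \<phi> \<le> 1"
  shows "continuous_on {0..} \<phi>"
proof (rule lipschitz_on_continuous_on)
  show "1-lipschitz_on {0..} \<phi>"
    using bl_norm_le_1D(2)[OF assms] by (intro lipschitz_onI) (auto simp: dist_real_def)
qed

lemma borel_measurable_test:
  assumes "bl_norm \<phi> \<le> 1"
  shows "(\<lambda>x. indicator {0..} x *\<^sub>R \<phi> x) \<in> borel_measurable borel"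
  using continuous_on_of_bl_norm[OF assms] by (intro borel_measurable_continuous_on_indicator) auto

text \<open>Since the survivors lie beyond \<open>t\<close>, the test function may be replaced by its constant extension
  to the left of the origin, which is Lipschitz on the whole line.\<close>

lemma integral_empirical:
  assumes "bl_norm \<phi> \<le> 1" "survivors (start f0 n ` {1..n}) H t \<subseteq> {t<..}"
  shows "(LINT x:{0..}|empirical f0 n H t. \<phi> x)
    = (\<Sum>x\<in>survivors (start f0 n ` {1..n}) H t. \<phi> (max 0 (x - t))) / n"
proof -
  let ?W = "survivors (start f0 n ` {1..n}) H t"
  let ?k = "\<lambda>x. indicator {0..} x *\<^sub>R \<phi> x"
  have [measurable]: "?k \<in> borel_measurable borel" by (rule borel_measurable_test[OF assms(1)])
  have "finite ?W" by (simp add: survivors_def)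
  have "(LINT x:{0..}|empirical f0 n H t. \<phi> x)
      = (1 / n) * (LINT x|distr (count_space ?W) borel (\<lambda>x. x - t). ?k x)"
    unfolding set_lebesgue_integral_def empirical_def by (rule integral_scale_measure) (simp_all del: real_scaleR_def)
  also have "(LINT x|distr (count_space ?W) borel (\<lambda>x. x - t). ?k x) = (LINT x|count_space ?W. ?k (x - t))"
    by (rule integral_distr) (simp_all del: real_scaleR_def)
  also have "\<dots> = (\<Sum>x\<in>?W. ?k (x - t))"
    using \<open>finite ?W\<close> by (rule lebesgue_integral_count_space_finite)
  also have "\<dots> = (\<Sum>x\<in>?W. \<phi> (max 0 (x - t)))"
    using assms(2) by (intro sum.cong) (auto simp: indicator_def max_def)
  finally show ?thesis by simp
qed

lemma survivors_antimono: "t \<le> t' \<Longrightarrow> survivors A H t' \<subseteq> survivors A H t"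
  unfolding survivors_def by (rule Diff_mono[OF order_refl UN_mono]) auto

section \<open>From finitely many events to all times and all test functions\<close>

context
  fixes f0 :: "real \<Rightarrow> real"
  assumes f0: "half_line_density f0"
begin

interpretation F: real_distribution "F0_measure f0"
  by (rule real_distribution_F0[OF f0])

lemma integral_limit_measure:
  assumes "bl_norm \<phi> \<le> 1"
  shows "(LINT x:{0..}|limit_measure f0 t. \<phi> x)
    = rho f0 t * (LINT x:{t..}|F0_measure f0. \<phi> (max 0 (x - t)))"
proof -
  let ?k = "\<lambda>x. indicator {0..} x *\<^sub>R \<phi> x"
  let ?R = "restrict_space (F0_measure f0) {t..}"
  have [measurable]: "?k \<in> borel_measurable borel" by (rule borel_measurable_test[OF assms(1)])
  have sub: "(\<lambda>x. x - t) \<in> borel_measurable ?R" by (intro measurable_restrict_space1) simp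
  have "(LINT x:{0..}|limit_measure f0 t. \<phi> x) = rho f0 t * (LINT x|distr ?R borel (\<lambda>x. x - t). ?k x)"
    unfolding set_lebesgue_integral_def limit_measure_def shift_dual_def
    by (rule integral_scale_measure) (use rho_bounds[OF f0] in \<open>simp_all del: real_scaleR_def\<close>)
  also have "(LINT x|distr ?R borel (\<lambda>x. x - t). ?k x) = (LINT x|?R. ?k (x - t))"
    using sub by (rule integral_distr) (simp del: real_scaleR_def)
  also have "\<dots> = (LINT x|F0_measure f0. indicator {t..} x *\<^sub>R ?k (x - t))"
    by (rule integral_restrict_space) simp
  also have "\<dots> = (LINT x:{t..}|F0_measure f0. \<phi> (max 0 (x - t)))"
    unfolding set_lebesgue_integral_def
    by (intro Bochner_Integration.integral_cong) (auto simp: indicator_def max_def)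
  finally show ?thesis .
qed

lemma rho_antimono: "s \<le> t \<Longrightarrow> rho f0 t \<le> rho f0 s"
  using F.cdf_nondecreasing[of s t] by (simp add: rho_eq[OF f0])

lemma count_start_cells_tendsto:
  assumes "0 \<le> \<tau>" "0 < \<delta>" "U \<subseteq> {..p}"
  shows "(\<lambda>n. real (card (start f0 n ` {1..n} \<inter> (\<Union>j\<in>U. cell \<tau> \<delta> p j))) / n)
    \<longlonglongrightarrow> measure (F0_measure f0) (\<Union>j\<in>U. cell \<tau> \<delta> p j)"
proof -
  have "(\<lambda>n. real (card (start f0 n ` {1..n} \<inter> cell \<tau> \<delta> p j)) / n)
      \<longlonglongrightarrow> measure (F0_measure f0) (cell \<tau> \<delta> p j)" for j
  proof (cases "j < p")
    case True
    have "0 \<le> \<tau> + j * \<delta>" "\<tau> + j * \<delta> \<le> \<tau> + (real j + 1) * \<delta>"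
      using assms(1,2) by (simp_all add: algebra_simps)
    from count_start_Ioc_tendsto[OF f0 this] show ?thesis
      using True by (simp add: cell_def)
  next
    case False
    have "0 \<le> \<tau> + p * \<delta>" using assms(1,2) by simp
    from count_start_Ioi_tendsto[OF f0 this] show ?thesis
      using False by (simp add: cell_def)
  qed
  then have "(\<lambda>n. \<Sum>j\<in>U. real (card (start f0 n ` {1..n} \<inter> cell \<tau> \<delta> p j)) / n)
      \<longlonglongrightarrow> (\<Sum>j\<in>U. measure (F0_measure f0) (cell \<tau> \<delta> p j))"
    by (intro tendsto_sum)
  then show ?thesis
    using assms by (simp add: card_Int_Union_cells F.measure_Union_cells sum_divide_distrib)
qed

text \<open>The mean number of survivors in a set beyond \<open>\<tau>\<close> is the number of particles that started there
  times the probability of having a partner beyond \<open>\<tau>\<close>, which tends to \<open>\<rho>(\<tau>)\<close>.\<close>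

lemma expected_sum_tendsto:
  assumes "0 \<le> \<tau>" "0 < \<delta>" "U \<subseteq> {..p}"
  shows "(\<lambda>n. expected_sum (start f0 n ` {1..n}) \<tau> (indicator (\<Union>j\<in>U. cell \<tau> \<delta> p j)) / n)
    \<longlonglongrightarrow> rho f0 \<tau> * measure (F0_measure f0) (\<Union>j\<in>U. cell \<tau> \<delta> p j)"
proof -
  let ?A = "\<lambda>n. start f0 n ` {1..n}" and ?V = "\<Union>j\<in>U. cell \<tau> \<delta> p j"
  have V: "?V \<subseteq> {\<tau><..}" using cell_gt[OF assms(2)] by blast
  have "(\<lambda>n. real (card (?A n \<inter> ?V)) / n * ((real (card (?A n \<inter> {\<tau><..})) / n - 1 / real n) / (1 - 1 / real n)))
      \<longlonglongrightarrow> measure (F0_measure f0) ?V * ((measure (F0_measure f0) {\<tau><..} - 0) / (1 - 0))"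
    by (intro tendsto_mult tendsto_divide tendsto_diff tendsto_const lim_1_over_n
        count_start_cells_tendsto assms count_start_Ioi_tendsto[OF f0]) auto
  moreover have "eventually (\<lambda>n. real (card (?A n \<inter> ?V)) / n * ((real (card (?A n \<inter> {\<tau><..})) / n - 1 / real n) / (1 - 1 / real n))
      = expected_sum (?A n) \<tau> (indicator ?V) / n) sequentially"
  proof (rule eventually_mono[OF eventually_gt_at_top[of 1]])
    fix n :: nat assume n: "1 < n"
    have "(\<Sum>x\<in>?A n \<inter> {\<tau><..}. indicator ?V x) = real (card (?A n \<inter> {\<tau><..} \<inter> ?V))"
      by (rule sum_indicator_card) simp
    also have "?A n \<inter> {\<tau><..} \<inter> ?V = ?A n \<inter> ?V" using V by blast
    finally have "expected_sum (?A n) \<tau> (indicator ?V)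
        = real (card (?A n \<inter> ?V)) * (real (card (?A n \<inter> {\<tau><..})) - 1) / (real n - 1)"
      using card_start[OF f0, of n] n by (simp add: expected_sum_def)
    moreover have "(b / n - 1 / real n) / (1 - 1 / real n) = (b - 1) / (real n - 1)" for b
      using n by (simp add: field_simps)
    ultimately show "real (card (?A n \<inter> ?V)) / n * ((real (card (?A n \<inter> {\<tau><..})) / n - 1 / real n) / (1 - 1 / real n))
        = expected_sum (?A n) \<tau> (indicator ?V) / n"
      by simp
  qed
  ultimately show ?thesis
    by (simp add: tendsto_cong measure_F0_Ioi_rho[OF f0] mult.commute)
qed

text \<open>Between the grid times \<open>a = \<tau> j \<le> t \<le> b = \<tau> (j + 1)\<close> the survivors are squeezed: those of \<open>b\<close> are
  among those of \<open>t\<close>, which are among those of \<open>a\<close>. The number lost from \<open>a\<close> to \<open>b\<close> is known from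
  the estimates at the grid times, as it is close to \<open>n (\<rho>(a)\<^sup>2 - \<rho>(b)\<^sup>2)\<close>. Comparing at time
  \<open>t\<close> hence reduces to comparing at time \<open>b\<close>, with the test function still centred at \<open>t\<close>.
  The three errors are \<open>6 \<eta>\<close> for the particles lost, \<open>10 \<eta>\<close> for the comparison at \<open>b\<close> and \<open>2 \<eta>\<close> for
  the change of the limit between \<open>t\<close> and \<open>b\<close>.\<close>

lemma close_at_grid_imp_close:
  fixes n p q :: nat and T \<eta> t :: real
  defines "A \<equiv> start f0 n ` {1..n}"
    and "\<tau> \<equiv> \<lambda>i. real i * T / real q"
  assumes n: "0 < n" "even n" and H: "H \<in> set_pmf (particle_law f0 n)"
    and q: "0 < q" and \<eta>: "0 < \<eta>"
    and modulus: "F0_modulus f0 (T / q) \<le> \<eta>" and tail: "rho f0 (p * \<eta>) \<le> \<eta>"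
    and grid: "\<And>i U. i \<le> q \<Longrightarrow> U \<subseteq> {..p} \<Longrightarrow>
      \<bar>card (survivors A H (\<tau> i) \<inter> (\<Union>j\<in>U. cell (\<tau> i) \<eta> p j)) / n
        - rho f0 (\<tau> i) * measure (F0_measure f0) (\<Union>j\<in>U. cell (\<tau> i) \<eta> p j)\<bar> \<le> 2 * \<eta>"
    and t: "0 \<le> t" "t \<le> T" "0 < T" and \<phi>: "bl_norm \<phi> \<le> 1"
  shows "\<bar>(LINT x:{0..}|empirical f0 n H t. \<phi> x) - (LINT x:{0..}|limit_measure f0 t. \<phi> x)\<bar> \<le> 18 * \<eta>"
proof -
  have A: "finite A" "card A = n" using card_start[OF f0 n(1)] by (auto simp: A_def)
  have gt: "survivors A H s \<subseteq> {s<..}" for s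
    using survivors_gt[OF A(1)] A(2) n(2) H by (simp add: particle_law_def A_def)
  have finW: "finite (survivors A H s)" for s using A by (simp add: survivors_def)
  have cardW: "card (survivors A H s) \<le> n" for s
    using card_mono[OF A(1), of "survivors A H s"] A(2) by (auto simp: survivors_def)
  define \<psi> where "\<psi> x = \<phi> (max 0 (x - t))" for x
  have \<psi>: "\<bar>\<psi> x\<bar> \<le> 1" "\<bar>\<psi> x - \<psi> y\<bar> \<le> \<bar>x - y\<bar>" for x y
  proof -
    show "\<bar>\<psi> x\<bar> \<le> 1" unfolding \<psi>_def by (rule bl_norm_le_1D[OF \<phi>]) simp
    have "\<bar>\<psi> x - \<psi> y\<bar> \<le> \<bar>max 0 (x - t) - max 0 (y - t)\<bar>"
      unfolding \<psi>_def by (rule bl_norm_le_1D[OF \<phi>]) simp_all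
    then show "\<bar>\<psi> x - \<psi> y\<bar> \<le> \<bar>x - y\<bar>" by linarith
  qed
  have "1-lipschitz_on UNIV \<psi>" using \<psi>(2) by (intro lipschitz_onI) (auto simp: dist_real_def)
  then have [measurable]: "\<psi> \<in> borel_measurable borel"
    by (intro borel_measurable_continuous_onI lipschitz_on_continuous_on)

  \<comment> \<open>The minimum keeps \<open>j < q\<close> at \<open>t = T\<close>, so that \<open>\<tau> (Suc j)\<close> is a grid time.\<close>
  define j where "j = min (nat \<lfloor>t * q / T\<rfloor>) (q - 1)"
  have j: "j < q" "\<tau> j \<le> t" "t \<le> \<tau> (Suc j)"
  proof -
    have tq: "0 \<le> t * q / T" "t * q / T \<le> q" using t mult_right_mono[OF t(2), of "real q"] by (auto simp: field_simps)
    show "j < q" using q by (simp add: j_def)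
    have "real j \<le> t * q / T" using tq unfolding j_def by linarith
    then show "\<tau> j \<le> t" using t q by (simp add: \<tau>_def field_simps)
    have "t * q / T \<le> real (Suc j)"
    proof (cases "nat \<lfloor>t * q / T\<rfloor> \<le> q - 1")
      case True
      then have "j = nat \<lfloor>t * q / T\<rfloor>" by (simp add: j_def)
      then show ?thesis using tq by linarith
    next
      case False
      then have "Suc j = q" using q by (simp add: j_def)
      then show ?thesis using tq by simp
    qed
    then show "t \<le> \<tau> (Suc j)" using t q by (simp add: \<tau>_def field_simps)
  qed
  let ?a = "\<tau> j" and ?b = "\<tau> (Suc j)"
  have ab: "0 \<le> ?a" "?b - ?a = T / q" using t by (auto simp: \<tau>_def add_divide_distrib distrib_right)
  have mod: "rho f0 x - rho f0 y \<le> \<eta>" if "?a \<le> x" "x \<le> y" "y \<le> ?b" for x y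
    using modulus_bound[OF f0, of x y "T / q"] that ab modulus by linarith

  have cells: "\<bar>card (survivors A H (\<tau> i)) / n - rho f0 (\<tau> i) * rho f0 (\<tau> i)\<bar> \<le> 2 * \<eta>" if "i \<le> q" for i
  proof -
    have "survivors A H (\<tau> i) \<inter> {\<tau> i<..} = survivors A H (\<tau> i)" using gt by blast
    then show ?thesis
      using grid[OF that, of "{..p}"] by (simp add: Union_cells[OF \<eta>] measure_F0_Ioi_rho[OF f0])
  qed
  have "rho f0 ?a * rho f0 ?a - rho f0 ?b * rho f0 ?b = (rho f0 ?a - rho f0 ?b) * (rho f0 ?a + rho f0 ?b)"
    by (simp add: algebra_simps)
  also have "\<dots> \<le> \<eta> * 2"
    using mod[of ?a ?b] j rho_bounds[OF f0, of ?a] rho_bounds[OF f0, of ?b] \<eta> by (intro mult_mono) auto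
  finally have lost: "card (survivors A H ?a) / n - card (survivors A H ?b) / n \<le> 6 * \<eta>"
    using cells[of j] cells[of "Suc j"] j(1) by (simp add: abs_le_iff)

  have sub: "survivors A H ?b \<subseteq> survivors A H t" "survivors A H t \<subseteq> survivors A H ?a"
    using j by (auto intro: survivors_antimono[THEN subsetD])
  have "\<bar>(\<Sum>x\<in>survivors A H t. \<psi> x) - (\<Sum>x\<in>survivors A H ?b. \<psi> x)\<bar>
      = \<bar>\<Sum>x\<in>survivors A H t - survivors A H ?b. \<psi> x\<bar>"
    using sub finW by (simp add: sum_diff)
  also have "\<dots> \<le> (\<Sum>x\<in>survivors A H t - survivors A H ?b. 1)"
    using \<psi>(1) by (intro order_trans[OF sum_abs] sum_mono) auto
  also have "\<dots> = real (card (survivors A H t)) - card (survivors A H ?b)"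
    using card_Diff_subset[OF finW sub(1)] card_mono[OF finW sub(1)] by (simp add: of_nat_diff)
  also have "\<dots> \<le> real (card (survivors A H ?a)) - card (survivors A H ?b)"
    using card_mono[OF finW sub(2)] by simp
  finally have "\<bar>(\<Sum>x\<in>survivors A H t. \<psi> x) - (\<Sum>x\<in>survivors A H ?b. \<psi> x)\<bar> / n
      \<le> (real (card (survivors A H ?a)) - card (survivors A H ?b)) / n"
    by (rule divide_right_mono) simp
  then have 1: "\<bar>(\<Sum>x\<in>survivors A H t. \<psi> x) / n - (\<Sum>x\<in>survivors A H ?b. \<psi> x) / n\<bar> \<le> 6 * \<eta>"
    using lost n by (simp flip: diff_divide_distrib add: abs_divide)

  have 2: "\<bar>(\<Sum>x\<in>survivors A H ?b. \<psi> x) / n - rho f0 ?b * (LINT x:{?b<..}|F0_measure f0. \<psi> x)\<bar> \<le> 10 * \<eta>"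
  proof -
    have "measure (F0_measure f0) {?b + p * \<eta><..} \<le> \<eta>"
      using rho_antimono[of "p * \<eta>" "?b + p * \<eta>"] tail t j by (simp add: measure_F0_Ioi_rho[OF f0])
    then have "\<bar>(\<Sum>x\<in>survivors A H ?b. \<psi> x) / n - rho f0 ?b * (LINT x:{?b<..}|F0_measure f0. \<psi> x)\<bar>
        \<le> 2 * \<eta> + 2 * \<eta> + 3 * (2 * \<eta>)"
      using j(1) grid[of "Suc j"]
      by (intro F.close_on_cells_imp_close[OF finW gt cardW n(1) _ _ \<eta>] rho_bounds[OF f0] \<psi>) auto
    then show ?thesis by simp
  qed

  have 3: "\<bar>rho f0 t * (LINT x:{t..}|F0_measure f0. \<psi> x) - rho f0 ?b * (LINT x:{?b<..}|F0_measure f0. \<psi> x)\<bar> \<le> 2 * \<eta>"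
  proof -
    let ?I = "\<lambda>B. LINT x:B|F0_measure f0. \<psi> x"
    have "{t..} = {t..?b} \<union> {?b<..}" using j by auto
    then have "?I {t..} = ?I {t..?b} + ?I {?b<..}"
      using \<psi>(1) by (simp only:) (intro set_integral_Un F.set_integral_bound(1), auto)
    moreover have "\<bar>?I {t..?b}\<bar> \<le> measure (F0_measure f0) {t..?b}"
      using \<psi>(1) by (intro F.set_integral_bound(2)) auto
    moreover have "measure (F0_measure f0) {t..?b} \<le> \<eta>"
      using mod[of t ?b] j by (simp add: measure_F0_Icc[OF f0] rho_eq[OF f0])
    ultimately have I: "\<bar>?I {t..} - ?I {?b<..}\<bar> \<le> \<eta>" by linarith
    have I1: "\<bar>?I {t..}\<bar> \<le> 1"
      using F.set_integral_bound(2)[of "{t..}" \<psi>] \<psi>(1) F.prob_le_1[of "{t..}"] by (auto intro: order_trans)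
    have r: "0 \<le> rho f0 t - rho f0 ?b" "rho f0 t - rho f0 ?b \<le> \<eta>"
      using mod[of t ?b] rho_antimono[of t ?b] j by auto
    have "rho f0 t * ?I {t..} - rho f0 ?b * ?I {?b<..}
        = (rho f0 t - rho f0 ?b) * ?I {t..} + rho f0 ?b * (?I {t..} - ?I {?b<..})"
      by (simp add: algebra_simps)
    moreover have "\<bar>(rho f0 t - rho f0 ?b) * ?I {t..}\<bar> \<le> \<eta> * 1"
      unfolding abs_mult using r I1 by (intro mult_mono) auto
    moreover have "\<bar>rho f0 ?b * (?I {t..} - ?I {?b<..})\<bar> \<le> 1 * \<eta>"
      unfolding abs_mult using rho_bounds[OF f0, of ?b] I by (intro mult_mono) auto
    ultimately show ?thesis by linarith
  qed
  have "(LINT x:{0..}|empirical f0 n H t. \<phi> x) = (\<Sum>x\<in>survivors A H t. \<psi> x) / n"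
    using integral_empirical[OF \<phi>, of f0 n H t] gt[of t] by (simp add: A_def \<psi>_def)
  moreover have "(LINT x:{0..}|limit_measure f0 t. \<phi> x) = rho f0 t * (LINT x:{t..}|F0_measure f0. \<psi> x)"
    using integral_limit_measure[OF \<phi>] by (simp add: \<psi>_def)
  ultimately show ?thesis using 1 2 3 by linarith
qed

text \<open>The union bound over \<open>q + 1\<close> grid times and \<open>2 ^ (p + 1)\<close> unions of cells. Each bad event is a
  deviation of \<open>n \<epsilon> / 20\<close> from the expectation, of probability at most
  \<open>2 exp (- (n \<epsilon> / 20)\<^sup>2 / (16 n))\<close>; the expectations themselves are deterministic and within
  \<open>n \<epsilon> / 20\<close> of their limits once \<open>n\<close> is large, which is the only source of the threshold on \<open>n\<close>.
  The total error is then \<open>18 \<epsilon> / 20 < \<epsilon>\<close>.\<close>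

lemma exceedance_bound:
  fixes p q :: nat and T \<epsilon> :: real
  assumes \<epsilon>: "0 < \<epsilon>" and T: "0 < T" and q: "0 < q"
    and modulus: "F0_modulus f0 (T / q) \<le> \<epsilon> / 20" and tail: "rho f0 (p * (\<epsilon> / 20)) \<le> \<epsilon> / 20"
  shows "eventually (\<lambda>n. even n \<longrightarrow>
    measure_pmf.prob (particle_law f0 n)
      {H. ereal \<epsilon> < (SUP t \<in> {0..T}. bl_dist (empirical f0 n H t) (limit_measure f0 t))}
    \<le> 4 * (2 ^ p * (real q + 1)) * exp (- (1 / 6400) * real n * \<epsilon>\<^sup>2)) sequentially"
proof -
  define \<eta> where "\<eta> = \<epsilon> / 20"
  have \<eta>: "0 < \<eta>" using \<epsilon> by (simp add: \<eta>_def)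
  define \<tau> where "\<tau> i = real i * T / real q" for i
  have \<tau>: "0 \<le> \<tau> i" for i using T by (simp add: \<tau>_def)
  define V where "V i U = (\<Union>j\<in>U. cell (\<tau> i) \<eta> p j)" for i U
  define A where "A n = start f0 n ` {1..n}" for n
  define X where "X = {..q} \<times> Pow {..p}"
  have X: "finite X" "real (card X) = (real q + 1) * (2 * 2 ^ p)"
    by (auto simp: X_def card_Pow card_cartesian_product algebra_simps)
  have "eventually (\<lambda>n. \<forall>(i, U)\<in>X. \<bar>expected_sum (A n) (\<tau> i) (indicator (V i U)) / n
      - rho f0 (\<tau> i) * measure (F0_measure f0) (V i U)\<bar> < \<eta>) sequentially"
  proof (rule eventually_ball_finite[OF X(1)], safe)
    fix i U assume "(i, U) \<in> X"
    then have "(\<lambda>n. expected_sum (A n) (\<tau> i) (indicator (V i U)) / n)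
        \<longlonglongrightarrow> rho f0 (\<tau> i) * measure (F0_measure f0) (V i U)"
      unfolding A_def V_def X_def by (intro expected_sum_tendsto \<tau> \<eta>) auto
    from tendstoD[OF this \<eta>]
    show "eventually (\<lambda>n. \<bar>expected_sum (A n) (\<tau> i) (indicator (V i U)) / n
      - rho f0 (\<tau> i) * measure (F0_measure f0) (V i U)\<bar> < \<eta>) sequentially"
      by (simp add: dist_real_def)
  qed
  then show ?thesis
  proof (rule eventually_mono[OF eventually_conj[OF eventually_gt_at_top[of 0]]], intro impI, elim conjE)
    fix n :: nat
    assume n: "0 < n" "even n"
      and E: "\<forall>(i, U)\<in>X. \<bar>expected_sum (A n) (\<tau> i) (indicator (V i U)) / n
        - rho f0 (\<tau> i) * measure (F0_measure f0) (V i U)\<bar> < \<eta>"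
    have A: "finite (A n)" "card (A n) = n" "A n \<noteq> {}" using card_start[OF f0 n(1)] n by (auto simp: A_def)
    let ?Z = "\<lambda>i U H. \<Sum>x\<in>survivors (A n) H (\<tau> i). indicator (V i U) x :: real"
    define bad where "bad = (\<lambda>(i, U). {H. \<eta> * n \<le> \<bar>?Z i U H - expected_sum (A n) (\<tau> i) (indicator (V i U))\<bar>})"
    have law: "particle_law f0 n = removal_law (A n)" by (simp add: particle_law_def A_def)
    have prob_bad: "measure_pmf.prob (removal_law (A n)) (bad z) \<le> 2 * exp (- (1 / 6400) * real n * \<epsilon>\<^sup>2)" for z
    proof -
      have "measure_pmf.prob (removal_law (A n)) (bad z) \<le> 2 * exp (- ((\<eta> * n)\<^sup>2 / (16 * card (A n))))"
        unfolding bad_def split_beta using A n \<eta>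
        by (intro survivor_sum_concentration) (auto simp: indicator_def)
      also have "- ((\<eta> * n)\<^sup>2 / (16 * card (A n))) = - (1 / 6400) * real n * \<epsilon>\<^sup>2"
        using A n by (simp add: \<eta>_def power2_eq_square field_simps)
      finally show ?thesis .
    qed
    have good: "(SUP t \<in> {0..T}. bl_dist (empirical f0 n H t) (limit_measure f0 t)) \<le> ereal \<epsilon>"
      if H: "H \<in> set_pmf (removal_law (A n))" "H \<notin> (\<Union>z\<in>X. bad z)" for H
    proof -
      have grid: "\<bar>card (survivors (A n) H (\<tau> i) \<inter> V i U) / n
          - rho f0 (\<tau> i) * measure (F0_measure f0) (V i U)\<bar> \<le> 2 * \<eta>"
        if "i \<le> q" "U \<subseteq> {..p}" for i U
      proof -
        have iU: "(i, U) \<in> X" using that by (simp add: X_def)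
        have "finite (survivors (A n) H (\<tau> i))" using A by (simp add: survivors_def)
        then have "?Z i U H = card (survivors (A n) H (\<tau> i) \<inter> V i U)" by (rule sum_indicator_card)
        then have "\<bar>card (survivors (A n) H (\<tau> i) \<inter> V i U) - expected_sum (A n) (\<tau> i) (indicator (V i U))\<bar> < \<eta> * n"
          using H(2) iU by (auto simp: bad_def not_le)
        then have "\<bar>card (survivors (A n) H (\<tau> i) \<inter> V i U) / n - expected_sum (A n) (\<tau> i) (indicator (V i U)) / n\<bar> < \<eta>"
          using n by (simp flip: diff_divide_distrib add: abs_divide divide_less_eq)
        then show ?thesis using E iU by fastforce
      qed
      have close: "\<bar>(LINT x:{0..}|empirical f0 n H t. \<phi> x) - (LINT x:{0..}|limit_measure f0 t. \<phi> x)\<bar> \<le> 18 * \<eta>"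
        if "t \<in> {0..T}" "bl_norm \<phi> \<le> 1" for t \<phi>
        by (rule close_at_grid_imp_close[where p = p and q = q and T = T])
           (use n H law q \<eta> modulus tail grid that T in \<open>auto simp: \<eta>_def \<tau>_def V_def A_def\<close>)
      have "18 * \<eta> \<le> \<epsilon>" using \<epsilon> by (simp add: \<eta>_def)
      then show ?thesis
        unfolding bl_dist_def using close by (intro SUP_least) (fastforce simp: abs_le_iff)
    qed
    have "measure_pmf.prob (particle_law f0 n)
        {H. ereal \<epsilon> < (SUP t \<in> {0..T}. bl_dist (empirical f0 n H t) (limit_measure f0 t))}
      \<le> measure_pmf.prob (removal_law (A n)) (\<Union>z\<in>X. bad z)"
      unfolding law
      by (rule measure_pmf.finite_measure_mono_AE)
        (use good in \<open>auto simp: AE_measure_pmf_iff not_le[symmetric]\<close>)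
    also have "\<dots> \<le> (\<Sum>z\<in>X. measure_pmf.prob (removal_law (A n)) (bad z))"
      using X(1) by (intro measure_pmf.finite_measure_subadditive_finite) auto
    also have "\<dots> \<le> card X * (2 * exp (- (1 / 6400) * real n * \<epsilon>\<^sup>2))"
      by (rule sum_bounded_above) (rule prob_bad)
    also have "\<dots> = 4 * (2 ^ p * (real q + 1)) * exp (- (1 / 6400) * real n * \<epsilon>\<^sup>2)"
      by (simp add: X(2))
    finally show "measure_pmf.prob (particle_law f0 n)
        {H. ereal \<epsilon> < (SUP t \<in> {0..T}. bl_dist (empirical f0 n H t) (limit_measure f0 t))}
      \<le> 4 * (2 ^ p * (real q + 1)) * exp (- (1 / 6400) * real n * \<epsilon>\<^sup>2)" .
  qed
qed

lemma ex_tail_cells: "0 < \<eta> \<Longrightarrow> \<exists>p::nat. rho f0 (real p * \<eta>) \<le> \<eta>"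
proof -
  assume "0 < \<eta>"
  then have "filterlim (\<lambda>p. real p * \<eta>) at_top sequentially"
    using filterlim_tendsto_pos_mult_at_top[OF tendsto_const _ filterlim_real_sequentially]
    by (simp add: mult.commute)
  then have "(\<lambda>p. rho f0 (real p * \<eta>)) \<longlonglongrightarrow> 0"
    by (rule filterlim_compose[OF rho_tendsto_0[OF f0]])
  then have "eventually (\<lambda>p. rho f0 (real p * \<eta>) < \<eta>) sequentially"
    using \<open>0 < \<eta>\<close> by (rule order_tendstoD)
  then show ?thesis by (auto simp: eventually_sequentially intro: less_imp_le)
qed

lemma ex_time_steps:
  fixes T \<eta> :: real
  assumes "0 < \<eta>" "0 < T"
  shows "\<exists>q::nat. 0 < q \<and> F0_modulus f0 (T / real q) \<le> \<eta>"
proof -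
  obtain \<delta> where \<delta>: "0 < \<delta>" "\<And>d. 0 \<le> d \<Longrightarrow> d \<le> \<delta> \<Longrightarrow> F0_modulus f0 d \<le> \<eta>"
    using modulus_small[OF f0 assms(1)] by blast
  obtain q :: nat where q: "T / \<delta> < q" using reals_Archimedean2 by blast
  have "0 < T / \<delta>" using \<open>0 < T\<close> \<delta> by simp
  then have "0 < q" using q by linarith
  moreover have "T / q \<le> \<delta>" using q \<delta> \<open>0 < q\<close> by (simp add: field_simps)
  ultimately show ?thesis using \<delta>(2)[of "T / q"] \<open>0 < T\<close> by auto
qed

end

text \<open>
  \<open>M\<close> counts, up to a constant factor, the unions of cells and \<open>N\<close> the grid times. The number of
  cells is chosen from \<open>\<epsilon>\<close> and the tail \<open>\<rho>\<close>, the number of time steps from \<open>\<epsilon>\<close>, the modulus of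
  continuity and \<open>T\<close>. Each choice exists because \<open>\<rho>\<close> vanishes at infinity and \<open>F\<^sub>0\<close> is uniformly
  continuous.\<close>

theorem theorem3:
  "\<exists>(K::real) (\<kappa>::real). 0 < K \<and> 0 < \<kappa> \<and>
     (\<exists>(M :: real \<Rightarrow> (real \<Rightarrow> real) \<Rightarrow> real) (N :: real \<Rightarrow> (real \<Rightarrow> real) \<Rightarrow> real \<Rightarrow> real).
        \<forall>f0. half_line_density f0 \<longrightarrow>
          (\<forall>\<epsilon>>0. \<forall>T>0. \<exists>n\<^sub>0::nat. \<forall>n::nat. n\<^sub>0 \<le> n \<and> 0 < n \<and> even n \<longrightarrow>
             measure_pmf.prob (particle_law f0 n)
               {H. ereal \<epsilon> < (SUP t \<in> {0..T}. bl_dist (empirical f0 n H t) (limit_measure f0 t))}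
             \<le> K * (M \<epsilon> (rho f0) * N \<epsilon> (F0_modulus f0) T + 1 / \<epsilon>) * exp (- \<kappa> * real n * \<epsilon>\<^sup>2)))"
proof -
  define p where "p \<epsilon> R = (SOME p. R (real p * (\<epsilon> / 20)) \<le> \<epsilon> / 20)" for \<epsilon> :: real and R :: "real \<Rightarrow> real"
  define q where "q \<epsilon> \<omega> T = (SOME q. 0 < q \<and> \<omega> (T / real q) \<le> \<epsilon> / 20)" for \<epsilon> T :: real and \<omega> :: "real \<Rightarrow> real"
  have "\<exists>n\<^sub>0::nat. \<forall>n::nat. n\<^sub>0 \<le> n \<and> 0 < n \<and> even n \<longrightarrow>
       measure_pmf.prob (particle_law f0 n)
         {H. ereal \<epsilon> < (SUP t \<in> {0..T}. bl_dist (empirical f0 n H t) (limit_measure f0 t))}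
       \<le> 4 * (2 ^ p \<epsilon> (rho f0) * (real (q \<epsilon> (F0_modulus f0) T) + 1) + 1 / \<epsilon>) * exp (- (1 / 6400) * real n * \<epsilon>\<^sup>2)"
    if f0: "half_line_density f0" and \<epsilon>: "0 < \<epsilon>" and T: "0 < T" for f0 \<epsilon> T
  proof -
    let ?p = "p \<epsilon> (rho f0)" and ?q = "q \<epsilon> (F0_modulus f0) T"
    have tail: "rho f0 (real ?p * (\<epsilon> / 20)) \<le> \<epsilon> / 20"
      unfolding p_def by (rule someI_ex[OF ex_tail_cells[OF f0]]) (use \<epsilon> in simp)
    have "\<exists>q::nat. 0 < q \<and> F0_modulus f0 (T / real q) \<le> \<epsilon> / 20"
      by (rule ex_time_steps[OF f0]) (use \<epsilon> T in simp_all)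
    then have "0 < ?q \<and> F0_modulus f0 (T / real ?q) \<le> \<epsilon> / 20"
      unfolding q_def by (rule someI_ex)
    then have "eventually (\<lambda>n. even n \<longrightarrow>
      measure_pmf.prob (particle_law f0 n)
        {H. ereal \<epsilon> < (SUP t \<in> {0..T}. bl_dist (empirical f0 n H t) (limit_measure f0 t))}
      \<le> 4 * (2 ^ ?p * (real ?q + 1)) * exp (- (1 / 6400) * real n * \<epsilon>\<^sup>2)) sequentially"
      using exceedance_bound[OF f0 \<epsilon> T _ _ tail] by blast
    then obtain n0 where n0: "\<And>n. n0 \<le> n \<Longrightarrow> even n \<Longrightarrow>
      measure_pmf.prob (particle_law f0 n)
        {H. ereal \<epsilon> < (SUP t \<in> {0..T}. bl_dist (empirical f0 n H t) (limit_measure f0 t))}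
      \<le> 4 * (2 ^ ?p * (real ?q + 1)) * exp (- (1 / 6400) * real n * \<epsilon>\<^sup>2)"
      by (auto simp: eventually_sequentially)
    have "4 * (2 ^ ?p * (real ?q + 1)) * exp (- (1 / 6400) * real n * \<epsilon>\<^sup>2)
        \<le> 4 * (2 ^ ?p * (real ?q + 1) + 1 / \<epsilon>) * exp (- (1 / 6400) * real n * \<epsilon>\<^sup>2)" for n
      using \<epsilon> by (intro mult_right_mono) auto
    with n0 show ?thesis by (meson order_trans)
  qed
  then show ?thesis
    by (intro exI[of _ 4] exI[of _ "1 / 6400"] conjI
        exI[of _ "\<lambda>\<epsilon> R. 2 ^ p \<epsilon> R"] exI[of _ "\<lambda>\<epsilon> \<omega> T. real (q \<epsilon> \<omega> T) + 1"]) auto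
qed

end
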